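(* Let $K$ be a field and $S=K[x_1,\ldots,x_n]$. Let $0\leq m\leq n$ be two integers. Let $a_i\geq 1$, for $1\leq i\leq n$, and $b_i\geq a_i$, for $1\leq i\leq m$, be some integers. Then $$\operatorname{sdepth}_S\big((x_1^{a_1},\ldots,x_n^{a_n})/(x_1^{b_1},\ldots,x_m^{b_m})\big)=n-m-\left\lfloor \frac{n-m}{2}\right\rfloor,$$ and thus $$\operatorname{sdepth}_S\big((x_1^{a_1},\ldots,x_n^{a_n})/(x_1^{b_1},\ldots,x_m^{b_m})\big)\geq \operatorname{depth}_S\big((x_1^{a_1},\ldots,x_n^{a_n})/(x_1^{b_1},\ldots,x_m^{b_m})\big).$$
   Context: For $m=0$ the ideal $(x_1^{b_1},\ldots,x_m^{b_m})$ is the zero ideal. $\operatorname{depth}_S$ denotes the usual depth of an $S$-module. Let $S=K[x_1,\ldots,x_n]$ with its standard $\mathbb Z^n$-grading and let $M$ be a $\mathbb Z^n$-graded $S$-module. A Stanley decomposition of $M$ is a direct sum $\mathcal D: M=\bigoplus_{i=1}^r m_iK[Z_i]$ as a $\mathbb Z^n$-graded $K$-vector space, where each $m_i\in M$ is homogeneous with respect to the $\mathbb Z^n$-grading, $Z_i\subset\{x_1,\ldots,x_n\}$, and $m_iK[Z_i]=\{um_i: u\in K[Z_i]\}\subset M$ is a free $K[Z_i]$-submodule of $M$. Put $\operatorname{sdepth}(\mathcal D)=\min_{i=1,\ldots,r}|Z_i|$ and $\operatorname{sdepth}_S(M)=\max\{\operatorname{sdepth}(\mathcal D): \mathcal D \text{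 is a Stanley decomposition of } M\}$; this is the Stanley depth of $M$. *)

theory Defs
  imports
    "HOL-Algebra.QuotRing"
    "HOL-Algebra.Module"
    "HOL-Library.Poly_Mapping"
    "HOL-Library.Extended_Nat"
begin

type_synonym 'k mpoly = "(nat \<Rightarrow>\<^sub>0 nat) \<Rightarrow>\<^sub>0 'k"

definition var :: "nat \<Rightarrow> 'k::field mpoly" where
  "var i = Poly_Mapping.single (Poly_Mapping.single i 1) 1"

text \<open>\<^term>\<open>poly_in Z\<close> is the set of polynomials in the variables \<open>x\<^sub>i\<close>, \<open>i \<in> Z\<close>, i.e. \<open>K[Z]\<close>.\<close>

definition poly_in :: "nat set \<Rightarrow> 'k::field mpoly set" where
  "poly_in Z = {p. \<forall>t\<in>Poly_Mapping.keys p. Poly_Mapping.keys t \<subseteq> Z}"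

definition poly_ring :: "nat \<Rightarrow> 'k::field mpoly ring" where
  "poly_ring n =
    \<lparr>carrier = poly_in {1..n}, mult = (*), one = 1, zero = 0, add = (+)\<rparr>"

text \<open>The component of \<open>S = K[x\<^sub>1,\<dots>,x\<^sub>n]\<close> in multidegree \<open>\<alpha>\<close>: it is \<open>K x\<^sup>\<alpha>\<close> if
  \<open>\<alpha>\<close> is a vector of naturals supported in \<open>{1..n}\<close>, and \<open>0\<close> otherwise.\<close>

definition poly_component :: "nat \<Rightarrow> (nat \<Rightarrow> int) \<Rightarrow> 'k::field mpoly set" where
  "poly_component n \<alpha> =
    {p \<in> carrier (poly_ring n).
      \<forall>t\<in>Poly_Mapping.keys p. \<forall>i. int (Poly_Mapping.lookup t i) = \<alpha> i}"

text \<open>Vectors in \<open>\<int>\<^sup>n\<close> are functions vanishing outside \<open>{1..n}\<close>.\<close>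

definition Zn :: "nat \<Rightarrow> (nat \<Rightarrow> int) set" where
  "Zn n = {\<alpha>. \<forall>i. i \<notin> {1..n} \<longrightarrow> \<alpha> i = 0}"

text \<open>\<open>I/J\<close> as a module over \<open>R\<close>, for ideals \<open>J \<subseteq> I\<close> of \<open>R\<close>. The fields \<^const>\<open>mult\<close> and
  \<^const>\<open>one\<close> of the record play no role for modules.\<close>

definition quot_module :: "('a, 'c) ring_scheme \<Rightarrow> 'a set \<Rightarrow> 'a set \<Rightarrow> ('a, 'a set) module" where
  "quot_module R I J =
    \<lparr>carrier = (\<lambda>f. J +>\<^bsub>R\<^esub> f) ` I, mult = rcoset_mult R J, one = J +>\<^bsub>R\<^esub> \<one>\<^bsub>R\<^esub>,
     zero = J, add = set_add R, smult = (\<lambda>r X. rcoset_mult R J (J +>\<^bsub>R\<^esub> r) X)\<rparr>"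

text \<open>The \<open>\<int>\<^sup>n\<close>-grading which \<open>I/J\<close> inherits from \<open>S\<close> for monomial ideals \<open>J \<subseteq> I\<close>: the component
  in degree \<open>\<alpha>\<close> is the image of \<open>I \<inter> S\<^sub>\<alpha>\<close>.\<close>

definition quot_grading ::
    "nat \<Rightarrow> 'k::field mpoly set \<Rightarrow> 'k mpoly set \<Rightarrow> (nat \<Rightarrow> int) \<Rightarrow> 'k mpoly set set" where
  "quot_grading n I J \<alpha> = (\<lambda>f. J +>\<^bsub>poly_ring n\<^esub> f) ` (I \<inter> poly_component n \<alpha>)"

text \<open>In the following definitions \<open>M\<close> is a module over \<^term>\<open>poly_ring n\<close> and \<open>G \<alpha>\<close>, \<open>\<alpha> \<in> \<int>\<^sup>n\<close>, are
  the components of a \<open>\<int>\<^sup>n\<close>-grading of \<open>M\<close>.\<close>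

definition stanley_space :: "('k::field mpoly, 'm) module \<Rightarrow> 'm \<Rightarrow> nat set \<Rightarrow> 'm set" where
  "stanley_space M w Z = (\<lambda>u. u \<odot>\<^bsub>M\<^esub> w) ` poly_in Z"

text \<open>A Stanley decomposition is the list of its pairs \<open>(m\<^sub>i, Z\<^sub>i)\<close>. Freeness says that \<open>m\<^sub>i\<close> is a
  \<open>K[Z\<^sub>i]\<close>-basis of \<open>m\<^sub>iK[Z\<^sub>i]\<close>; in particular \<open>m\<^sub>i \<noteq> 0\<close>. As the \<open>m\<^sub>i\<close> are
  homogeneous, all summands are graded subspaces, so that a direct sum of vector spaces is
  automatically one of graded vector spaces.\<close>

definition is_stanley_decomposition ::
    "nat \<Rightarrow> ('k::field mpoly, 'm) module \<Rightarrow> ((nat \<Rightarrow> int) \<Rightarrow> 'm set) \<Rightarrow> ('m \<times> nat set) list \<Rightarrow> bool" where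
  "is_stanley_decomposition n M G D \<longleftrightarrow>
    (\<forall>(w, Z) \<in> set D.
        w \<in> carrier M \<and> (\<exists>\<alpha>\<in>Zn n. w \<in> G \<alpha>) \<and> Z \<subseteq> {1..n} \<and>
        inj_on (\<lambda>u. u \<odot>\<^bsub>M\<^esub> w) (poly_in Z)) \<and>
    (\<forall>v\<in>carrier M.
        \<exists>!c. c \<in> (\<Pi>\<^sub>E i\<in>{..<length D}. stanley_space M (fst (D ! i)) (snd (D ! i))) \<and>
             v = (\<Oplus>\<^bsub>M\<^esub>i\<in>{..<length D}. c i))"

text \<open>The empty decomposition occurs only for the zero module; it is given Stanley depth \<open>0\<close>, so
  that the zero module has Stanley depth \<open>0\<close>.\<close>

definition decomposition_sdepth :: "('m \<times> nat set) list \<Rightarrow> nat" where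
  "decomposition_sdepth D = (if D = [] then 0 else Min ((\<lambda>(w, Z). card Z) ` set D))"

definition sdepth ::
    "nat \<Rightarrow> ('k::field mpoly, 'm) module \<Rightarrow> ((nat \<Rightarrow> int) \<Rightarrow> 'm set) \<Rightarrow> nat" where
  "sdepth n M G = Max {decomposition_sdepth D | D. is_stanley_decomposition n M G D}"

text \<open>The submodule \<open>(f\<^sub>1,\<dots>,f\<^sub>k)M = f\<^sub>1M + \<dots> + f\<^sub>kM\<close>.\<close>

definition list_smult :: "('a, 'm) module \<Rightarrow> 'a list \<Rightarrow> 'm set" where
  "list_smult M fs =
    {(\<Oplus>\<^bsub>M\<^esub>j\<in>{..<length fs}. (fs ! j) \<odot>\<^bsub>M\<^esub> v j) | v. v \<in> {..<length fs} \<rightarrow> carrier M}"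

text \<open>Every \<open>f\<^sub>j\<close> is a nonzerodivisor on \<open>M/(f\<^sub>1,\<dots>,f\<^bsub>j-1\<^esub>)M\<close>, and \<open>M \<noteq> (f\<^sub>1,\<dots>,f\<^sub>k)M\<close>.\<close>

definition regular_sequence :: "('a, 'c) ring_scheme \<Rightarrow> ('a, 'm) module \<Rightarrow> 'a list \<Rightarrow> bool" where
  "regular_sequence R M fs \<longleftrightarrow>
    set fs \<subseteq> carrier R \<and>
    (\<forall>j<length fs. \<forall>v\<in>carrier M.
        (fs ! j) \<odot>\<^bsub>M\<^esub> v \<in> list_smult M (take j fs) \<longrightarrow> v \<in> list_smult M (take j fs)) \<and>
    list_smult M fs \<noteq> carrier M"

text \<open>The depth of a graded module over \<open>S\<close> is taken with respect to the graded maximal ideal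
  \<open>(x\<^sub>1,\<dots>,x\<^sub>n)\<close>. The zero module has no regular sequence at all, not even the empty one, so its
  depth is \<open>Sup {} = 0\<close>.\<close>

definition depth :: "nat \<Rightarrow> ('k::field mpoly, 'm) module \<Rightarrow> enat" where
  "depth n M =
    Sup {enat (length fs) | fs.
      set fs \<subseteq> Idl\<^bsub>poly_ring n\<^esub> (var ` {1..n}) \<and> regular_sequence (poly_ring n) M fs}"

end

theory Submission
  imports Defs
begin

text \<open>Put \<open>p = n - m\<close>. Both ideals are spanned by monomials, so \<open>I/J\<close> has a basis of classes of
monomials; their exponent vectors form the set \<open>E\<close> of all \<open>t\<close> with \<open>t\<^sub>i < b\<^sub>i\<close> for every \<open>i \<le> m\<close> and
\<open>t\<^sub>i \<ge> a\<^sub>i\<close> for some \<open>i\<close>. Because the generators of the summands are homogeneous, a Stanley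
decomposition of \<open>I/J\<close> is the same thing as a partition of \<open>E\<close> into finitely many cones
\<open>t + \<nat>\<^sup>Z\<close> (\<open>stanley_decomposition_cones\<close> and \<open>stanley_decomposition_of_cones\<close>), and the Stanley
depth asks how large the sets \<open>Z\<close> can simultaneously be.

\<^bold>\<open>Upper bound\<close> (\<open>cones_upper_bound\<close>). A direction \<open>j \<le> m\<close> cannot occur in any \<open>Z\<close>, since a power
of \<open>x\<^sub>j\<close> kills \<open>I/J\<close>. Let \<open>w\<close> have the coordinates \<open>a\<^sub>i - 1\<close>. It lies just outside \<open>E\<close>, but
\<open>w + e\<^sub>j \<in> E\<close> for each of the \<open>p\<close> indices \<open>j > m\<close>. A cone containing two of these vectors would
contain \<open>w\<close>, so they lie in \<open>p\<close> different cones. If every cone has at least \<open>d\<close> directions, these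
cones contain at least \<open>p d\<close> of the vectors \<open>w + e\<^sub>j + e\<^sub>l\<close>, of which there are only \<open>p (p + 1) / 2\<close>.
Hence \<open>2 d \<le> p + 1\<close>.

\<^bold>\<open>Lower bound\<close> (\<open>cone_partition_exists\<close>). To \<open>t \<in> E\<close> attach the set \<open>T = {i > m. t\<^sub>i \<ge> a\<^sub>i}\<close>. An
interval partition of the nonempty subsets of \<open>{m+1,\<dots>,n}\<close> into \<open>[A, B]\<close> with \<open>2 |B| \<ge> p\<close> is lifted to
cones: the vectors with \<open>T \<in> [A, B]\<close> and prescribed coordinates outside \<open>B\<close> form one cone with
direction set \<open>B\<close>. If already some \<open>t\<^sub>i \<ge> a\<^sub>i\<close> with \<open>i \<le> m\<close>, then \<open>T = {}\<close> is permitted as well and the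
whole power set serves as a single interval.

\<^bold>\<open>Interval partitions\<close> (\<open>interval_partition_exists\<close>). For odd \<open>l\<close> read a subset of an \<open>l\<close>-element
set as a circular word in \<open>0\<close> and \<open>1\<close>. Every nonzero such word has exactly one tiling by the tiles
\<open>1\<close>, \<open>10\<close> and \<open>00\<close>: behind each \<open>1\<close> stands a run of zeros, and the parity of its length decides
whether that \<open>1\<close> is a tile of its own or opens a domino \<open>10\<close>. Fixing the positions of the tiles and
leaving the first letter of each domino free describes an interval \<open>[A, B]\<close>, where \<open>A\<close> consists of
the single tiles and \<open>B\<close> adds the first letters of the dominoes. Since \<open>B\<close> contains at least one
letter of every tile, it has at least half of all elements. For even \<open>l\<close> all sets containing one
chosen element form an interval, and the other sets fall under the odd case.

\<^bold>\<open>Depth.\<close> A nonzero \<open>I/J\<close> with \<open>m = n\<close> contains a monomial killed by all variables, so its depth is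
\<open>0\<close>. If \<open>m < n\<close>, the depth is at most \<open>1\<close>, which is at most the Stanley depth: for a regular
sequence \<open>f, g, \<dots>\<close> the element \<open>f x\<^sup>w \<in> I\<close> is multiplied into \<open>f I\<close> by \<open>g\<close>, because
\<open>g x\<^sup>w \<in> I\<close>, although it is not in \<open>f I\<close> modulo \<open>J\<close>, because \<open>x\<^sup>w \<notin> I\<close>.\<close>

section \<open>Interval partitions of the nonempty subsets of a finite set\<close>

text \<open>Tilings of linear words of length \<open>l\<close>, one interval for each tiling: a tile \<open>1\<close> puts its position
into both bounds, and a domino, whose second letter is \<open>0\<close>, puts its first position into the upper
bound only. The recursion removes the last tile.\<close>

fun tilings :: "nat \<Rightarrow> (nat set \<times> nat set) set" where
  "tilings 0 = {({}, {})}"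
| "tilings (Suc 0) = {({0}, {0})}"
| "tilings (Suc (Suc l)) =
     (\<lambda>(A, B). (insert (Suc l) A, insert (Suc l) B)) ` tilings (Suc l) \<union>
     (\<lambda>(A, B). (A, insert l B)) ` tilings l"

lemma tilings_bounds:
  "(A, B) \<in> tilings l \<Longrightarrow> A \<subseteq> B \<and> B \<subseteq> {..<l} \<and> l \<le> 2 * card B"
proof (induction l arbitrary: A B rule: tilings.induct)
  case (3 l)
  from "3.prems" consider
    A' B' where "(A', B') \<in> tilings (Suc l)" "A = insert (Suc l) A'" "B = insert (Suc l) B'"
  | B' where "(A, B') \<in> tilings l" "B = insert l B'"
    by auto
  then show ?case
  proof cases
    case 1
    with "3.IH"(1)[OF 1(1)] have *: "A' \<subseteq> B'" "B' \<subseteq> {..<Suc l}" "Suc l \<le> 2 * card B'" by auto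
    then have "finite B'" "Suc l \<notin> B'" by (auto intro: finite_subset)
    then have "card B = Suc (card B')" using 1 by simp
    with * 1 show ?thesis by auto
  next
    case 2
    with "3.IH"(2)[OF 2(1)] have *: "A \<subseteq> B'" "B' \<subseteq> {..<l}" "l \<le> 2 * card B'" by auto
    then have "finite B'" "l \<notin> B'" by (auto intro: finite_subset)
    then have "card B = Suc (card B')" using 2 by simp
    with * 2 show ?thesis by auto
  qed
qed auto

abbreviation in_interval :: "'a set \<Rightarrow> 'a set \<times> 'a set \<Rightarrow> bool" where
  "in_interval T P \<equiv> fst P \<subseteq> T \<and> T \<subseteq> snd P"

definition leading_zeros :: "nat \<Rightarrow> nat set \<Rightarrow> nat" where
  "leading_zeros l T = Min (insert l T)"

lemma Min_insert_upper_bound: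
  fixes u :: "'a::linorder"
  assumes "finite T" "x \<in> T" "x \<le> u"
  shows "Min (insert u T) = Min T"
proof -
  have "Min T \<le> u" using Min_le[OF assms(1,2)] assms(3) by (rule order_trans)
  moreover have "Min (insert u T) = min u (Min T)" using assms by (intro Min_insert) auto
  ultimately show ?thesis by (simp only: min_absorb2)
qed

lemma leading_zeros_monomer:
  assumes "T \<subseteq> {..<Suc (Suc l)}" "Suc l \<in> T"
  shows "leading_zeros (Suc (Suc l)) T = leading_zeros (Suc l) (T - {Suc l})"
proof -
  have fin: "finite T" using assms(1) by (rule finite_subset) simp
  have "insert (Suc l) (T - {Suc l}) = T" using assms(2) by auto
  moreover have "Min (insert (Suc (Suc l)) T) = Min T"
    using fin assms(2) by (rule Min_insert_upper_bound) simp
  ultimately show ?thesis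
    by (simp add: leading_zeros_def)
qed

lemma leading_zeros_dimer:
  assumes "T \<subseteq> {..<Suc (Suc l)}" "Suc l \<notin> T"
  shows "even (leading_zeros (Suc (Suc l)) T) = even (leading_zeros l (T - {l}))"
proof -
  have fin: "finite T" using assms(1) by (rule finite_subset) simp
  show ?thesis
  proof (cases "T = {}")
    case True
    then show ?thesis by (simp add: leading_zeros_def)
  next
    case False
    have sub: "T \<subseteq> {..l}"
    proof
      fix x assume "x \<in> T"
      with assms have "x < Suc (Suc l)" "x \<noteq> Suc l" by auto
      then show "x \<in> {..l}" by simp
    qed
    obtain x where x: "x \<in> T" "x \<le> l" using False sub by blast
    have "Min (insert l (T - {l})) = Min T"
    proof -
      have "Min (insert l (T - {l})) = Min (insert l T)" by simp
      also have "\<dots> = Min T" using fin x by (rule Min_insert_upper_bound)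
      finally show ?thesis .
    qed
    moreover have "Min (insert (Suc (Suc l)) T) = Min T"
      using fin x(1) by (rule Min_insert_upper_bound) (use x(2) in simp)
    ultimately show ?thesis by (simp add: leading_zeros_def)
  qed
qed

text \<open>A linear word can be tiled exactly if it begins with an even number of zeros: no tile has a \<open>1\<close>
as second letter, so the tiles to the left of the first \<open>1\<close> are dominoes \<open>00\<close> that fill up the leading
zeros. This parity is an invariant of removing the last tile.\<close>

lemma tilings_cover:
  assumes "T \<subseteq> {..<l}" "even (leading_zeros l T)"
  shows "\<exists>P\<in>tilings l. in_interval T P"
  using assms
proof (induction l arbitrary: T rule: tilings.induct)
  case 2
  then have "T = {} \<or> T = {0}" by auto
  with 2 have "T = {0}" by (auto simp: leading_zeros_def)
  then show ?case by simp
next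
  case (3 l)
  show ?case
  proof (cases "Suc l \<in> T")
    case True
    have "T - {Suc l} \<subseteq> {..<Suc l}" using "3.prems"(1) by auto
    moreover have "even (leading_zeros (Suc l) (T - {Suc l}))"
      using "3.prems" True leading_zeros_monomer by metis
    ultimately obtain P where "P \<in> tilings (Suc l)" "in_interval (T - {Suc l}) P"
      using "3.IH"(1) by blast
    then obtain A B where "(A, B) \<in> tilings (Suc l)" "A \<subseteq> T - {Suc l}" "T - {Suc l} \<subseteq> B"
      by (cases P) simp
    with True show ?thesis
      by (intro bexI[of _ "(insert (Suc l) A, insert (Suc l) B)"]) auto
  next
    case False
    have "T - {l} \<subseteq> {..<l}" using "3.prems"(1) False by (auto simp: less_Suc_eq)
    moreover have "even (leading_zeros l (T - {l}))"
      using "3.prems" False leading_zeros_dimer by metis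
    ultimately obtain P where "P \<in> tilings l" "in_interval (T - {l}) P"
      using "3.IH"(2) by blast
    then obtain A B where "(A, B) \<in> tilings l" "A \<subseteq> T - {l}" "T - {l} \<subseteq> B"
      by (cases P) simp
    then show ?thesis
      by (intro bexI[of _ "(A, insert l B)"]) auto
  qed
qed auto

lemma tilings_even_leading_zeros:
  assumes "P \<in> tilings l" "in_interval T P"
  shows "even (leading_zeros l T)"
  using assms
proof (induction l arbitrary: P T rule: tilings.induct)
  case (3 l)
  have T: "T \<subseteq> {..<Suc (Suc l)}"
    using tilings_bounds[of "fst P" "snd P" "Suc (Suc l)"] "3.prems" by auto
  from "3.prems" consider
    A B where "(A, B) \<in> tilings (Suc l)" "P = (insert (Suc l) A, insert (Suc l) B)"
  | A B where "(A, B) \<in> tilings l" "P = (A, insert l B)"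
    by auto
  then show ?case
  proof cases
    case 1
    with tilings_bounds[OF 1(1)] "3.prems"(2) have "in_interval (T - {Suc l}) (A, B)" "Suc l \<in> T" by auto
    with "3.IH"(1)[OF 1(1)] leading_zeros_monomer[OF T] show ?thesis by simp
  next
    case 2
    with tilings_bounds[OF 2(1)] "3.prems"(2) have "in_interval (T - {l}) (A, B)" "Suc l \<notin> T"
      by fastforce+
    with "3.IH"(2)[OF 2(1)] leading_zeros_dimer[OF T] show ?thesis by simp
  qed
next
  case 2
  then have "T = {0}" by auto
  then show ?case by (simp add: leading_zeros_def)
qed (auto simp: leading_zeros_def)

text \<open>The last letter determines the last tile: a final \<open>1\<close> is a tile of its own, and a final \<open>0\<close> can only
be the second letter of a domino.\<close>

lemma tilings_unique:
  assumes "P \<in> tilings l" "Q \<in> tilings l" "in_interval T P" "in_interval T Q"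
  shows "P = Q"
  using assms
proof (induction l arbitrary: P Q T rule: tilings.induct)
  case (3 l)
  have split: "(\<exists>A B. (A, B) \<in> tilings (Suc l) \<and> R = (insert (Suc l) A, insert (Suc l) B) \<and>
        in_interval (T - {Suc l}) (A, B) \<and> Suc l \<in> T) \<or>
      (\<exists>A B. (A, B) \<in> tilings l \<and> R = (A, insert l B) \<and> in_interval (T - {l}) (A, B) \<and> Suc l \<notin> T)"
    if "R \<in> tilings (Suc (Suc l))" "in_interval T R" for R
  proof -
    from that(1) consider
      A B where "(A, B) \<in> tilings (Suc l)" "R = (insert (Suc l) A, insert (Suc l) B)"
    | A B where "(A, B) \<in> tilings l" "R = (A, insert l B)"
      by auto
    then show ?thesis
    proof cases
      case 1
      with tilings_bounds[OF 1(1)] that(2) have "in_interval (T - {Suc l}) (A, B)" "Suc l \<in> T" by auto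
      with 1 show ?thesis by blast
    next
      case 2
      with tilings_bounds[OF 2(1)] that(2) have "in_interval (T - {l}) (A, B)" "Suc l \<notin> T"
      by fastforce+
      with 2 show ?thesis by blast
    qed
  qed
  show ?case
  proof (cases "Suc l \<in> T")
    case True
    with split[OF "3.prems"(1,3)] split[OF "3.prems"(2,4)] "3.IH"(1) show ?thesis
      by (elim disjE exE conjE) blast+
  next
    case False
    with split[OF "3.prems"(1,3)] split[OF "3.prems"(2,4)] "3.IH"(2) show ?thesis
      by (elim disjE exE conjE) blast+
  qed
qed auto

definition interval_partition :: "'a set \<Rightarrow> ('a set \<times> 'a set) set \<Rightarrow> bool" where
  "interval_partition X F \<longleftrightarrow>
    (\<forall>(A, B)\<in>F. A \<noteq> {} \<and> A \<subseteq> B \<and> B \<subseteq> X \<and> card X \<le> 2 * card B) \<and>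
    (\<forall>T\<subseteq>X. T \<noteq> {} \<longrightarrow> (\<exists>!P. P \<in> F \<and> in_interval T P))"

declare tilings.simps(3) [simp del]

text \<open>A tiling of the circular word either is a tiling of the linear word, or it has one domino that
consists of the last letter followed by the first one; the remaining letters are then tiled linearly.
The two kinds cover the words with an even and with an odd number of leading zeros. As the length is
odd, the zero word is covered by neither.\<close>

lemma interval_partition_odd:
  "\<exists>F. interval_partition {..<2 * k + 1 :: nat} F"
proof (cases k)
  case 0
  have "interval_partition {..<1::nat} {({0}, {0})}"
    by (auto simp: interval_partition_def)
  with 0 show ?thesis by auto
next
  case (Suc j)
  define l where "l = 2 * j + 1"
  have l: "2 * k + 1 = Suc (Suc l)" "odd l" using Suc by (auto simp: l_def)
  \<comment> \<open>\<open>wrap\<close> adds the domino across the end of the word: its first letter is at position \<open>l + 1\<close>, its second one at \<open>0\<close>.\<close>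
  define wrap where "wrap = (\<lambda>(A, B). (Suc ` A, insert (Suc l) (Suc ` B)) :: nat set \<times> nat set)"
  define F where "F = tilings (Suc (Suc l)) \<union> wrap ` tilings l"
  define unwrap where "unwrap T = {i. Suc i \<in> T \<and> i < l}" for T
  have unwrap: "P \<in> tilings l \<Longrightarrow> in_interval T (wrap P) \<Longrightarrow> 0 \<notin> T \<and> in_interval (unwrap T) P" for P T
    using tilings_bounds[of "fst P" "snd P" l] by (cases P) (auto simp: wrap_def unwrap_def)
  have lz: "leading_zeros (Suc (Suc l)) T = Suc (leading_zeros l (unwrap T))"
    if T: "T \<subseteq> {..<Suc (Suc l)}" "T \<noteq> {}" "0 \<notin> T" for T
  proof -
    have fin: "finite T" using T(1) by (rule finite_subset) simp
    obtain x where x: "x \<in> T" using T(2) by blast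
    have "Min (insert (Suc (Suc l)) T) = Min T"
      using fin x by (rule Min_insert_upper_bound) (use x T(1) in auto)
    also have "Min T = Min (insert (Suc l) T)"
      using fin x by (rule Min_insert_upper_bound[symmetric]) (use x T(1) in auto)
    also have "insert (Suc l) T = Suc ` insert l (unwrap T)"
    proof (intro equalityI subsetI)
      fix y assume "y \<in> insert (Suc l) T"
      with T show "y \<in> Suc ` insert l (unwrap T)" by (cases y) (auto simp: unwrap_def less_Suc_eq)
    qed (auto simp: unwrap_def)
    also have "Min (Suc ` insert l (unwrap T)) = Suc (Min (insert l (unwrap T)))"
      by (rule mono_Min_commute[symmetric]) (auto simp: mono_def unwrap_def)
    finally show ?thesis by (simp add: leading_zeros_def)
  qed
  have not_empty: "\<not> in_interval {} P" if PF: "P \<in> F" for P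
  proof
    assume P: "in_interval {} P"
    show False
    proof (cases "P \<in> tilings (Suc (Suc l))")
      case True
      then show False using tilings_even_leading_zeros[OF True P] l(2) by (simp add: leading_zeros_def)
    next
      case False
      then obtain Q where Q: "Q \<in> tilings l" "P = wrap Q" using PF unfolding F_def by blast
      then have "in_interval {} Q" using unwrap[OF Q(1), of "{}"] P by (simp add: unwrap_def)
      then show False using tilings_even_leading_zeros[OF Q(1), of "{}"] l(2) by (simp add: leading_zeros_def)
    qed
  qed
  have bounds: "A \<noteq> {} \<and> A \<subseteq> B \<and> B \<subseteq> {..<Suc (Suc l)} \<and> Suc (Suc l) \<le> 2 * card B"
    if AB: "(A, B) \<in> F" for A B
  proof -
    have "A \<subseteq> B \<and> B \<subseteq> {..<Suc (Suc l)} \<and> Suc (Suc l) \<le> 2 * card B"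
    proof (cases "(A, B) \<in> tilings (Suc (Suc l))")
      case True
      then show ?thesis using tilings_bounds by blast
    next
      case False
      then obtain A' B' where Q: "(A', B') \<in> tilings l" "A = Suc ` A'" "B = insert (Suc l) (Suc ` B')"
        using AB unfolding F_def wrap_def by auto
      with tilings_bounds[OF Q(1)] have *: "A' \<subseteq> B'" "B' \<subseteq> {..<l}" "l \<le> 2 * card B'" by auto
      then have "finite B'" "Suc l \<notin> Suc ` B'" by (auto intro: finite_subset)
      then have "card B = Suc (card B')" using Q by (simp add: card_image)
      with * Q show ?thesis by auto
    qed
    moreover from this have "A \<noteq> {}" using not_empty[OF AB] by auto
    ultimately show ?thesis by blast
  qed
  have "\<exists>!P. P \<in> F \<and> in_interval T P" if T: "T \<subseteq> {..<Suc (Suc l)}" "T \<noteq> {}" for T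
  proof (cases "even (leading_zeros (Suc (Suc l)) T)")
    case True
    then obtain P where P: "P \<in> tilings (Suc (Suc l))" "in_interval T P"
      using tilings_cover[OF T(1)] by blast
    show ?thesis
    proof (rule ex1I[of _ P])
      show "P \<in> F \<and> in_interval T P" using P by (simp add: F_def)
      fix Q assume Q: "Q \<in> F \<and> in_interval T Q"
      have "Q \<in> tilings (Suc (Suc l))"
      proof (rule ccontr)
        assume "Q \<notin> tilings (Suc (Suc l))"
        then obtain R where R: "R \<in> tilings l" "Q = wrap R" using Q unfolding F_def by blast
        with unwrap[OF R(1), of T] Q have "0 \<notin> T" "in_interval (unwrap T) R" by auto
        with tilings_even_leading_zeros[OF R(1)] lz[OF T] True show False by simp
      qed
      then show "Q = P" using tilings_unique P Q by blast
    qed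
  next
    case False
    have "0 \<notin> T"
    proof
      assume "0 \<in> T"
      then have "Min (insert (Suc (Suc l)) T) = 0"
        using T(1) by (intro Min_eqI) (auto intro: finite_subset)
      with False show False by (simp add: leading_zeros_def)
    qed
    with False lz[OF T] have "even (leading_zeros l (unwrap T))" by simp
    moreover have "unwrap T \<subseteq> {..<l}" by (auto simp: unwrap_def)
    ultimately obtain R where R: "R \<in> tilings l" "in_interval (unwrap T) R"
      using tilings_cover by blast
    have TR: "in_interval T (wrap R)"
    proof -
      obtain A B where AB: "R = (A, B)" by (cases R)
      have "x \<in> insert (Suc l) (Suc ` B)" if x: "x \<in> T" for x
      proof (cases x)
        case 0
        with x \<open>0 \<notin> T\<close> show ?thesis by simp
      next
        case (Suc i)
        then have "i = l \<or> i < l" using x T(1) by auto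
        with x Suc R(2) show ?thesis by (auto simp: AB unwrap_def)
      qed
      with R(2) show ?thesis by (auto simp: AB wrap_def unwrap_def)
    qed
    show ?thesis
    proof (rule ex1I[of _ "wrap R"])
      show "wrap R \<in> F \<and> in_interval T (wrap R)" using R TR by (simp add: F_def)
      fix Q assume Q: "Q \<in> F \<and> in_interval T Q"
      have "Q \<notin> tilings (Suc (Suc l))"
        using tilings_even_leading_zeros[of Q "Suc (Suc l)" T] Q False by blast
      then obtain R' where R': "R' \<in> tilings l" "Q = wrap R'" using Q unfolding F_def by blast
      with unwrap[OF R'(1), of T] Q have "in_interval (unwrap T) R'" by auto
      then show "Q = wrap R" using R' R tilings_unique by blast
    qed
  qed
  with bounds have "interval_partition {..<Suc (Suc l)} F"
    unfolding interval_partition_def by auto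
  with l(1) show ?thesis by auto
qed

text \<open>The sets avoiding the last element are partitioned as in the odd case, whose bound
\<open>l \<le> 2 |B|\<close> with odd \<open>l\<close> already gives \<open>l + 1 \<le> 2 |B|\<close>.\<close>

lemma interval_partition_even:
  "\<exists>F. interval_partition {..<2 * k :: nat} F"
proof (cases k)
  case 0
  have "interval_partition {..<0::nat} {}"
    by (auto simp: interval_partition_def)
  with 0 show ?thesis by auto
next
  case (Suc j)
  define l where "l = 2 * j + 1"
  have l: "2 * k = Suc l" "odd l" using Suc by (auto simp: l_def)
  obtain F where F: "interval_partition {..<l} F"
    using interval_partition_odd[of j] unfolding l_def by blast
  have F1: "A \<noteq> {} \<and> A \<subseteq> B \<and> B \<subseteq> {..<l} \<and> l \<le> 2 * card B" if "(A, B) \<in> F" for A B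
    using F that unfolding interval_partition_def by auto
  have F2: "\<exists>!P. P \<in> F \<and> in_interval T P" if "T \<subseteq> {..<l}" "T \<noteq> {}" for T
    using F that unfolding interval_partition_def by auto
  let ?N = "({l}, {..<Suc l})"
  have "interval_partition {..<Suc l} (insert ?N F)"
    unfolding interval_partition_def
  proof (intro conjI ballI allI impI; clarify?)
    fix A B assume "(A, B) \<in> insert ?N F"
    moreover have "Suc l \<le> 2 * card B" if "(A, B) \<in> F"
    proof -
      have "l \<le> 2 * card B" using F1[OF that] by blast
      with l(2) show ?thesis by presburger
    qed
    ultimately show "A \<noteq> {} \<and> A \<subseteq> B \<and> B \<subseteq> {..<Suc l} \<and> card {..<Suc l} \<le> 2 * card B"
      using F1 by fastforce
  next
    fix T assume T: "T \<subseteq> {..<Suc l}" "T \<noteq> {}"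
    show "\<exists>!P. P \<in> insert ?N F \<and> in_interval T P"
    proof (cases "l \<in> T")
      case True
      then have "\<not> in_interval T P" if "P \<in> F" for P
        using F1[of "fst P" "snd P"] that by auto
      with True T show ?thesis by (intro ex1I[of _ ?N]) auto
    next
      case False
      then have "T \<subseteq> {..<l}" using T by (auto simp: less_Suc_eq)
      then have "\<exists>!P. P \<in> F \<and> in_interval T P" using F2 T(2) by simp
      moreover have "P \<in> insert ?N F \<and> in_interval T P \<longleftrightarrow> P \<in> F \<and> in_interval T P" for P
        using False by auto
      ultimately show ?thesis by (simp only:)
    qed
  qed
  with l(1) show ?thesis by auto
qed

lemma interval_partition_exists:
  assumes "finite X"
  shows "\<exists>F. interval_partition X F"
proof -
  obtain h where h: "bij_betw h {..<card X} X"
    using ex_bij_betw_nat_finite[OF assms] by (auto simp: atLeast0LessThan)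
  obtain F where F: "interval_partition {..<card X} F"
    using interval_partition_odd interval_partition_even by (metis oddE evenE)
  have F1: "A \<noteq> {} \<and> A \<subseteq> B \<and> B \<subseteq> {..<card X} \<and> card X \<le> 2 * card B" if "(A, B) \<in> F" for A B
    using F that unfolding interval_partition_def by auto
  have F2: "\<exists>!P. P \<in> F \<and> in_interval T P" if "T \<subseteq> {..<card X}" "T \<noteq> {}" for T
    using F that unfolding interval_partition_def by auto
  have inj: "inj_on h {..<card X}" and im: "h ` {..<card X} = X" using h by (auto simp: bij_betw_def)
  let ?H = "\<lambda>(A, B). (h ` A, h ` B)"
  have sub: "h ` C \<subseteq> h ` D \<longleftrightarrow> C \<subseteq> D" if "C \<subseteq> {..<card X}" "D \<subseteq> {..<card X}" for C D
  proof
    assume *: "h ` C \<subseteq> h ` D"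
    show "C \<subseteq> D"
    proof
      fix x assume x: "x \<in> C"
      then have "h x \<in> h ` D" using * by blast
      then show "x \<in> D" using inj_on_image_mem_iff[OF inj] x that by blast
    qed
  qed auto
  have iff: "in_interval (h ` T) (?H P) \<longleftrightarrow> in_interval T P" if "P \<in> F" "T \<subseteq> {..<card X}" for P T
  proof -
    have "fst P \<subseteq> {..<card X}" "snd P \<subseteq> {..<card X}"
      using F1[of "fst P" "snd P"] that by auto
    with that(2) sub show ?thesis by (simp add: case_prod_beta)
  qed
  have "interval_partition X (?H ` F)"
    unfolding interval_partition_def
  proof (intro conjI ballI allI impI; clarify?)
    fix A B assume AB: "(A, B) \<in> F"
    then have "card (h ` B) = card B"
      using F1 inj by (meson card_image inj_on_subset)
    with F1[OF AB] im show "h ` A \<noteq> {} \<and> h ` A \<subseteq> h ` B \<and> h ` B \<subseteq> X \<and> card X \<le> 2 * card (h ` B)"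
      by auto
  next
    fix T' assume T': "T' \<subseteq> X" "T' \<noteq> {}"
    then obtain T where T: "T \<subseteq> {..<card X}" "T' = h ` T" using im by (metis subset_imageE)
    with T' F2 obtain P where P: "P \<in> F" "in_interval T P" and
      uniq: "\<And>Q. Q \<in> F \<and> in_interval T Q \<Longrightarrow> Q = P"
      by (metis image_is_empty)
    show "\<exists>!P. P \<in> ?H ` F \<and> in_interval T' P"
    proof (rule ex1I[of _ "?H P"])
      show "?H P \<in> ?H ` F \<and> in_interval T' (?H P)" using P iff[OF P(1) T(1)] T(2) by simp
      fix Q' assume Q': "Q' \<in> ?H ` F \<and> in_interval T' Q'"
      then obtain Q where Q: "Q \<in> F" "Q' = ?H Q" by blast
      with Q' T iff[OF Q(1) T(1)] have "in_interval T Q" by simp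
      with uniq Q show "Q' = ?H P" by blast
    qed
  qed
  then show ?thesis ..
qed

section \<open>Polynomials with prescribed exponents\<close>

abbreviation keys where "keys \<equiv> Poly_Mapping.keys"
abbreviation lookup where "lookup \<equiv> Poly_Mapping.lookup"
abbreviation monomial where "monomial \<equiv> Poly_Mapping.single"

definition monomial_space :: "(nat \<Rightarrow>\<^sub>0 nat) set \<Rightarrow> 'k::field mpoly set" where
  "monomial_space E = {p. keys p \<subseteq> E}"

lemma poly_in_eq_monomial_space: "poly_in Z = monomial_space {t. keys t \<subseteq> Z}"
  by (auto simp: poly_in_def monomial_space_def)

lemma monomial_space_iff: "p \<in> monomial_space E \<longleftrightarrow> (\<forall>t. t \<notin> E \<longrightarrow> lookup p t = 0)"
  by (auto simp: monomial_space_def in_keys_iff)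

lemma monomial_space_0 [simp]: "0 \<in> monomial_space E"
  by (simp add: monomial_space_def)

lemma monomial_space_add: "p \<in> monomial_space E \<Longrightarrow> q \<in> monomial_space E \<Longrightarrow> p + q \<in> monomial_space E"
  by (simp add: monomial_space_iff lookup_add)

lemma monomial_space_minus: "p \<in> monomial_space E \<Longrightarrow> q \<in> monomial_space E \<Longrightarrow> p - q \<in> monomial_space E"
  by (simp add: monomial_space_iff lookup_minus)

lemma monomial_space_uminus: "p \<in> monomial_space E \<Longrightarrow> - p \<in> monomial_space E"
  by (simp add: monomial_space_iff)

lemma monomial_space_sum: "(\<And>x. x \<in> X \<Longrightarrow> f x \<in> monomial_space E) \<Longrightarrow> sum f X \<in> monomial_space E"
  by (induction X rule: infinite_finite_induct) (auto intro: monomial_space_add)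

lemma monomial_space_single [simp]: "monomial t c \<in> monomial_space E \<longleftrightarrow> c = 0 \<or> t \<in> E"
  by (simp add: monomial_space_def)

lemma monomial_space_mono: "E \<subseteq> E' \<Longrightarrow> monomial_space E \<subseteq> monomial_space E'"
  by (auto simp: monomial_space_def)

lemma monomial_space_mult:
  assumes "p \<in> monomial_space E" "q \<in> monomial_space E'"
    and "\<And>s t. s \<in> E \<Longrightarrow> t \<in> E' \<Longrightarrow> s + t \<in> E''"
  shows "p * q \<in> monomial_space E''"
  using assms keys_mult[of p q] unfolding monomial_space_def by blast

lemma keys_add_nat: "keys (s + t) = keys s \<union> keys (t :: nat \<Rightarrow>\<^sub>0 nat)"
  by (auto simp: in_keys_iff lookup_add)

lemma lookup_mult_monomial:
  fixes p :: "'k::field mpoly"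
  shows "lookup (p * monomial t c) (s + t) = lookup p s * c"
proof -
  have "(\<Sum>q. lookup (monomial t c) q when s + t = l + q) = (c when l = s)" for l
  proof -
    have "(lookup (monomial t c) q when s + t = l + q) = ((c when l = s) when q = t)" for q
      by (auto simp: lookup_single when_def)
    then show ?thesis by simp
  qed
  then have "lookup (p * monomial t c) (s + t) = (\<Sum>l. lookup p l * (c when l = s))"
    by (simp add: lookup_mult)
  also have "\<dots> = (\<Sum>l. (lookup p s * c) when l = s)"
    by (rule Sum_any.cong) (simp add: when_def)
  finally show ?thesis by simp
qed

lemma keys_mult_monomial:
  fixes p :: "'k::field mpoly"
  assumes "c \<noteq> 0"
  shows "keys (p * monomial t c) = (\<lambda>s. s + t) ` keys p"
proof (intro equalityI subsetI)
  fix u assume "u \<in> keys (p * monomial t c)"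
  with keys_mult[of p "monomial t c"] show "u \<in> (\<lambda>s. s + t) ` keys p" by (auto split: if_splits)
next
  fix u assume "u \<in> (\<lambda>s. s + t) ` keys p"
  with assms show "u \<in> keys (p * monomial t c)" by (auto simp: in_keys_iff lookup_mult_monomial)
qed

lemma sum_monomials: "(\<Sum>t\<in>keys p. monomial t (lookup p t)) = p"
proof (rule poly_mapping_eqI)
  fix s
  have "lookup (\<Sum>t\<in>keys p. monomial t (lookup p t)) s = (\<Sum>t\<in>keys p. if t = s then lookup p t else 0)"
    unfolding lookup_sum by (rule sum.cong) (auto simp: lookup_single when_def)
  also have "\<dots> = lookup p s" by (simp add: in_keys_iff)
  finally show "lookup (\<Sum>t\<in>keys p. monomial t (lookup p t)) s = lookup p s" .
qed

definition restriction :: "(nat \<Rightarrow>\<^sub>0 nat) set \<Rightarrow> 'k::field mpoly \<Rightarrow> 'k mpoly" where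
  "restriction E p = (\<Sum>t\<in>keys p \<inter> E. monomial t (lookup p t))"

lemma lookup_restriction: "lookup (restriction E p) s = (if s \<in> E then lookup p s else 0)"
proof -
  have "lookup (restriction E p) s = (\<Sum>t\<in>keys p \<inter> E. if t = s then lookup p t else 0)"
    unfolding restriction_def lookup_sum by (rule sum.cong) (auto simp: lookup_single when_def)
  also have "\<dots> = (if s \<in> E then lookup p s else 0)" by (simp add: in_keys_iff)
  finally show ?thesis .
qed

section \<open>Ideals generated by powers of variables\<close>

lemma poly_ring_simps [simp]:
  "carrier (poly_ring n) = monomial_space {t. keys t \<subseteq> {1..n}}"
  "mult (poly_ring n) = (*)" "one (poly_ring n) = 1" "zero (poly_ring n) = 0" "add (poly_ring n) = (+)"
  by (simp_all add: poly_ring_def poly_in_eq_monomial_space)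

lemma poly_in_mult: "p \<in> monomial_space {t. keys t \<subseteq> Z} \<Longrightarrow> q \<in> monomial_space {t. keys t \<subseteq> Z} \<Longrightarrow>
    p * q \<in> monomial_space {t. keys t \<subseteq> Z}"
  by (erule monomial_space_mult) (auto simp: keys_add_nat)

lemma one_in_poly_in: "1 \<in> monomial_space {t. keys t \<subseteq> Z}"
  by (simp add: monomial_space_def)

lemma cring_poly_ring: "cring (poly_ring n :: 'k::field mpoly ring)"
proof (rule cringI)
  show "abelian_group (poly_ring n :: 'k mpoly ring)"
  proof (rule abelian_groupI)
    fix x :: "'k mpoly" assume "x \<in> carrier (poly_ring n)"
    then show "\<exists>y\<in>carrier (poly_ring n). y \<oplus>\<^bsub>poly_ring n\<^esub> x = \<zero>\<^bsub>poly_ring n\<^esub>"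
      by (intro bexI[of _ "- x"]) (auto intro: monomial_space_uminus)
  qed (auto intro: monomial_space_add simp: algebra_simps)
  show "Group.comm_monoid (poly_ring n :: 'k mpoly ring)"
    by (rule comm_monoidI) (auto intro: poly_in_mult one_in_poly_in simp: algebra_simps)
qed (auto simp: algebra_simps)

lemma ideal_monomial_space:
  assumes "E \<subseteq> {t. keys t \<subseteq> {1..n}}"
    and up: "\<And>s t. t \<in> E \<Longrightarrow> keys s \<subseteq> {1..n} \<Longrightarrow> s + t \<in> E"
  shows "ideal (monomial_space E) (poly_ring n :: 'k::field mpoly ring)"
proof -
  interpret cring "poly_ring n :: 'k mpoly ring" by (rule cring_poly_ring)
  have inv: "inv\<^bsub>add_monoid (poly_ring n)\<^esub> p = - p" if p: "p \<in> carrier (poly_ring n)" for p :: "'k mpoly"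
  proof -
    have "\<ominus>\<^bsub>poly_ring n\<^esub> p = - p"
      by (rule minus_equality) (use p in \<open>auto intro: monomial_space_uminus\<close>)
    then show ?thesis by (simp add: a_inv_def)
  qed
  have sub: "monomial_space E \<subseteq> (monomial_space {t. keys t \<subseteq> {1..n}} :: 'k mpoly set)"
    using assms(1) by (rule monomial_space_mono)
  show ?thesis
  proof (rule idealI)
    show "ring (poly_ring n :: 'k mpoly ring)" by (rule ring_axioms)
    show "subgroup (monomial_space E :: 'k mpoly set) (add_monoid (poly_ring n))"
    proof
      fix p :: "'k mpoly" assume p: "p \<in> monomial_space E"
      with sub have "inv\<^bsub>add_monoid (poly_ring n)\<^esub> p = - p" by (intro inv) auto
      then show "inv\<^bsub>add_monoid (poly_ring n)\<^esub> p \<in> monomial_space E"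
        using p by (simp only: monomial_space_uminus)
    qed (use sub in \<open>auto intro: monomial_space_add\<close>)
    fix p x :: "'k mpoly" assume "p \<in> monomial_space E" "x \<in> carrier (poly_ring n)"
    then have "x * p \<in> monomial_space E"
      by (auto intro!: monomial_space_mult[where E = "{t. keys t \<subseteq> {1..n}}" and E' = E] up)
    then show "x \<otimes>\<^bsub>poly_ring n\<^esub> p \<in> monomial_space E" "p \<otimes>\<^bsub>poly_ring n\<^esub> x \<in> monomial_space E"
      by (simp_all add: mult.commute)
  qed
qed

lemma var_power: "var i ^ e = (monomial (monomial i e) 1 :: 'k::field mpoly)"
proof (induction e)
  case (Suc e)
  then show ?case by (simp add: var_def mult_single single_add[symmetric])
qed simp

definition pure_power_exponents :: "nat \<Rightarrow> nat set \<Rightarrow> (nat \<Rightarrow> nat) \<Rightarrow> (nat \<Rightarrow>\<^sub>0 nat) set" where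
  "pure_power_exponents n X e = {t. keys t \<subseteq> {1..n} \<and> (\<exists>i\<in>X. e i \<le> lookup t i)}"

lemma pure_power_exponents_up:
  "t \<in> pure_power_exponents n X e \<Longrightarrow> keys s \<subseteq> {1..n} \<Longrightarrow> s + t \<in> pure_power_exponents n X e"
  by (auto simp: pure_power_exponents_def keys_add_nat lookup_add intro: trans_le_add2)

text \<open>Such an ideal is spanned by the monomials divisible by one of its generators, so membership can be
read off from the exponents.\<close>

lemma genideal_pure_powers:
  assumes "X \<subseteq> {1..n}"
  shows "Idl\<^bsub>poly_ring n\<^esub> {var i ^ e i | i. i \<in> X} =
    (monomial_space (pure_power_exponents n X e) :: 'k::field mpoly set)"
proof
  let ?G = "{var i ^ e i | i. i \<in> X} :: 'k mpoly set"
  let ?E = "pure_power_exponents n X e"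
  interpret cring "poly_ring n :: 'k mpoly ring" by (rule cring_poly_ring)
  have ideal: "ideal (monomial_space ?E :: 'k mpoly set) (poly_ring n)"
    by (rule ideal_monomial_space[OF _ pure_power_exponents_up]) (auto simp: pure_power_exponents_def)
  have G: "?G \<subseteq> monomial_space ?E"
  proof
    fix p :: "'k mpoly" assume "p \<in> ?G"
    then obtain i where i: "i \<in> X" "p = var i ^ e i" by blast
    then have "monomial i (e i) \<in> ?E"
      using assms by (auto simp: pure_power_exponents_def intro!: bexI[of _ i])
    then show "p \<in> monomial_space ?E" by (simp add: i(2) var_power)
  qed
  then show "Idl\<^bsub>poly_ring n\<^esub> ?G \<subseteq> monomial_space ?E"
    by (rule genideal_minimal[OF ideal])
  have "?G \<subseteq> carrier (poly_ring n)"
    using assms by (auto simp: var_power)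
  then interpret Id: ideal "Idl\<^bsub>poly_ring n\<^esub> ?G" "poly_ring n" by (rule genideal_ideal)
  have GI: "?G \<subseteq> Idl\<^bsub>poly_ring n\<^esub> ?G"
    by (rule genideal_self) fact
  have mono: "monomial t c \<in> Idl\<^bsub>poly_ring n\<^esub> ?G" if t: "t \<in> ?E" for t c
  proof -
    obtain i where i: "i \<in> X" "e i \<le> lookup t i" and keys: "keys t \<subseteq> {1..n}"
      using t by (auto simp: pure_power_exponents_def)
    define s where "s = t - monomial i (e i)"
    have t_eq: "t = monomial i (e i) + s"
      using i(2) by (intro poly_mapping_eqI) (auto simp: s_def lookup_add lookup_minus lookup_single when_def)
    have "var i ^ e i \<in> Idl\<^bsub>poly_ring n\<^esub> ?G" using GI i(1) by blast
    moreover have "monomial s c \<in> carrier (poly_ring n)"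
      using keys by (simp add: t_eq keys_add_nat)
    ultimately have "var i ^ e i \<otimes>\<^bsub>poly_ring n\<^esub> monomial s c \<in> Idl\<^bsub>poly_ring n\<^esub> ?G"
      by (rule Id.I_r_closed)
    then show ?thesis by (simp add: var_power mult_single t_eq)
  qed
  show "monomial_space ?E \<subseteq> Idl\<^bsub>poly_ring n\<^esub> ?G"
  proof
    fix p :: "'k mpoly" assume "p \<in> monomial_space ?E"
    then have sub: "keys p \<subseteq> ?E" by (simp add: monomial_space_def)
    have "(\<Sum>t\<in>T. monomial t (lookup p t)) \<in> Idl\<^bsub>poly_ring n\<^esub> ?G" if "finite T" "T \<subseteq> ?E" for T
      using that
    proof (induction T rule: finite_induct)
      case empty
      then show ?case using Id.zero_closed by simp
    next
      case (insert t T)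
      then show ?case using Id.a_closed[of "monomial t (lookup p t)"] mono by simp
    qed
    from this[OF _ sub] show "p \<in> Idl\<^bsub>poly_ring n\<^esub> ?G" by (simp add: sum_monomials)
  qed
qed

section \<open>Quotients of monomial ideals\<close>

text \<open>Ideals spanned by monomials, given by their sets of exponents. All computations with cosets below
reduce to polynomials through \<open>coset_eq_iff\<close>, \<open>smult_M\<close> and \<open>finsum_M\<close>.\<close>

locale monomial_quotient =
  fixes n :: nat and EI EJ :: "(nat \<Rightarrow>\<^sub>0 nat) set" and I J :: "'k::field mpoly set"
  assumes EJ_EI: "EJ \<subseteq> EI"
    and EI_keys: "EI \<subseteq> {t. keys t \<subseteq> {1..n}}"
    and EI_up: "\<And>s t. t \<in> EI \<Longrightarrow> keys s \<subseteq> {1..n} \<Longrightarrow> s + t \<in> EI"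
    and EJ_up: "\<And>s t. t \<in> EJ \<Longrightarrow> keys s \<subseteq> {1..n} \<Longrightarrow> s + t \<in> EJ"
    and I_def: "I = monomial_space EI"
    and J_def: "J = monomial_space EJ"
begin

abbreviation "R \<equiv> poly_ring n :: 'k mpoly ring"
abbreviation "M \<equiv> quot_module R I J"
abbreviation "coset f \<equiv> J +>\<^bsub>R\<^esub> f"

sublocale cring R by (rule cring_poly_ring)

sublocale J: ideal J R
  unfolding J_def by (rule ideal_monomial_space) (use EI_keys EJ_EI EJ_up in auto)

sublocale I: ideal I R
  unfolding I_def by (rule ideal_monomial_space) (use EI_keys EI_up in auto)

lemma I_carrier: "f \<in> I \<Longrightarrow> f \<in> carrier R"
  by (rule I.a_Hcarr)

lemma zero_I: "0 \<in> I"
  by (simp add: I_def)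

lemma add_I: "f \<in> I \<Longrightarrow> g \<in> I \<Longrightarrow> f + g \<in> I"
  unfolding I_def by (rule monomial_space_add)

lemma J_subset_I: "J \<subseteq> I"
  unfolding I_def J_def using EJ_EI by (rule monomial_space_mono)

lemma mult_I: "u \<in> carrier R \<Longrightarrow> f \<in> I \<Longrightarrow> u * f \<in> I"
  using I.I_l_closed by simp

lemma mult_J: "u \<in> carrier R \<Longrightarrow> f \<in> J \<Longrightarrow> u * f \<in> J"
  using J.I_l_closed by simp

lemma coset_eq_iff: "coset f = coset g \<longleftrightarrow> f - g \<in> J"
proof
  assume "coset f = coset g"
  moreover have "f \<in> coset f" by (auto simp: a_r_coset_def' J_def)
  ultimately obtain h where "h \<in> J" "f = h + g" by (auto simp: a_r_coset_def')
  then show "f - g \<in> J" by simp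
next
  have sub: "coset f \<subseteq> coset g" if fg: "f - g \<in> J" for f g
  proof
    fix x assume "x \<in> coset f"
    then obtain h where "h \<in> J" "x = h + f" by (auto simp: a_r_coset_def')
    with fg have "h + (f - g) \<in> J" "x = (h + (f - g)) + g" by (simp_all add: J_def monomial_space_add)
    then show "x \<in> coset g" by (force simp: a_r_coset_def')
  qed
  assume fg: "f - g \<in> J"
  then have "- (f - g) \<in> J" unfolding J_def by (rule monomial_space_uminus)
  then have "g - f \<in> J" by simp
  with fg show "coset f = coset g" using sub by blast
qed

lemma coset_0: "coset 0 = J"
  using J.a_rcos_const[of 0] by (simp add: J_def)

lemma coset_eq_J_iff: "coset f = J \<longleftrightarrow> f \<in> J"
  using coset_eq_iff[of f 0] by (simp add: coset_0)

lemma carrier_M: "carrier M = coset ` I" and zero_M: "\<zero>\<^bsub>M\<^esub> = J"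
  by (simp_all add: quot_module_def)

lemma coset_in_M: "f \<in> I \<Longrightarrow> coset f \<in> carrier M"
  by (simp add: carrier_M)

lemma add_M: "f \<in> carrier R \<Longrightarrow> g \<in> carrier R \<Longrightarrow> coset f \<oplus>\<^bsub>M\<^esub> coset g = coset (f + g)"
  using J.a_rcos_sum[of f g] by (simp add: quot_module_def)

lemma smult_M: "u \<in> carrier R \<Longrightarrow> f \<in> carrier R \<Longrightarrow> u \<odot>\<^bsub>M\<^esub> coset f = coset (u * f)"
  using J.rcoset_mult_add[of u f] by (simp add: quot_module_def)

lemma abelian_monoid_M: "abelian_monoid M"
proof (rule abelian_monoidI)
  fix x y assume "x \<in> carrier M" "y \<in> carrier M"
  then show "x \<oplus>\<^bsub>M\<^esub> y \<in> carrier M" "x \<oplus>\<^bsub>M\<^esub> y = y \<oplus>\<^bsub>M\<^esub> x"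
    by (auto simp: carrier_M add_M I_carrier add_I add.commute simp del: poly_ring_simps(1))
next
  show "\<zero>\<^bsub>M\<^esub> \<in> carrier M"
    using coset_in_M[OF zero_I] by (simp add: zero_M coset_0)
next
  fix x assume "x \<in> carrier M"
  then show "\<zero>\<^bsub>M\<^esub> \<oplus>\<^bsub>M\<^esub> x = x"
    using add_M[of 0] zero_closed by (auto simp: carrier_M zero_M coset_0 I_carrier simp del: poly_ring_simps(1))
next
  fix x y z assume "x \<in> carrier M" "y \<in> carrier M" "z \<in> carrier M"
  then show "x \<oplus>\<^bsub>M\<^esub> y \<oplus>\<^bsub>M\<^esub> z = x \<oplus>\<^bsub>M\<^esub> (y \<oplus>\<^bsub>M\<^esub> z)"
    by (auto simp: carrier_M add_M I_carrier add_I add.assoc simp del: poly_ring_simps(1))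
qed

lemma finsum_M:
  assumes "finite X" "\<And>i. i \<in> X \<Longrightarrow> f i \<in> I"
  shows "(\<Oplus>\<^bsub>M\<^esub>i\<in>X. coset (f i)) = coset (\<Sum>i\<in>X. f i) \<and> (\<Sum>i\<in>X. f i) \<in> I"
  using assms
proof (induction X rule: finite_induct)
  case empty
  interpret abelian_monoid M by (rule abelian_monoid_M)
  show ?case by (simp add: finsum_empty zero_M coset_0 zero_I)
next
  case (insert x X)
  interpret abelian_monoid M by (rule abelian_monoid_M)
  have f: "f i \<in> I" if "i \<in> insert x X" for i using insert.prems that by blast
  then have "(\<Oplus>\<^bsub>M\<^esub>i\<in>X. coset (f i)) = coset (\<Sum>i\<in>X. f i)" and sum: "(\<Sum>i\<in>X. f i) \<in> I"
    using insert.IH by auto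
  moreover have "(\<Oplus>\<^bsub>M\<^esub>i\<in>insert x X. coset (f i)) = coset (f x) \<oplus>\<^bsub>M\<^esub> (\<Oplus>\<^bsub>M\<^esub>i\<in>X. coset (f i))"
    using insert.hyps f by (intro finsum_insert) (auto simp: coset_in_M)
  ultimately show ?case
    using insert.hyps add_M[of "f x" "\<Sum>i\<in>X. f i"] f[of x] by (simp add: I_carrier add_I del: poly_ring_simps(1))
qed

end

section \<open>Stanley decompositions as partitions into cones\<close>

definition cone :: "(nat \<Rightarrow>\<^sub>0 nat) \<Rightarrow> nat set \<Rightarrow> (nat \<Rightarrow>\<^sub>0 nat) set" where
  "cone t Z = (\<lambda>s. s + t) ` {s. keys s \<subseteq> Z}"

lemma cone_iff:
  "u \<in> cone t Z \<longleftrightarrow> (\<forall>i. lookup t i \<le> lookup u i \<and> (i \<notin> Z \<longrightarrow> lookup u i = lookup t i))"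
proof
  assume "u \<in> cone t Z"
  then show "\<forall>i. lookup t i \<le> lookup u i \<and> (i \<notin> Z \<longrightarrow> lookup u i = lookup t i)"
    by (auto simp: cone_def lookup_add in_keys_iff subset_iff)
next
  assume u: "\<forall>i. lookup t i \<le> lookup u i \<and> (i \<notin> Z \<longrightarrow> lookup u i = lookup t i)"
  then have "u = (u - t) + t" by (intro poly_mapping_eqI) (simp add: lookup_add lookup_minus)
  moreover have "keys (u - t) \<subseteq> Z" using u by (auto simp: in_keys_iff lookup_minus)
  ultimately show "u \<in> cone t Z" unfolding cone_def by blast
qed

lemma apex_in_cone [simp]: "t \<in> cone t Z"
  by (simp add: cone_iff)

text \<open>The set of polynomials on the right is the Stanley space of \<open>c x\<^sup>t\<close> in the polynomial ring.\<close>

lemma mult_monomial_image_poly_in: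
  fixes c :: "'k::field"
  assumes "c \<noteq> 0"
  shows "(\<lambda>u. u * monomial t c) ` poly_in Z = monomial_space (cone t Z)"
proof (intro equalityI subsetI)
  fix p assume "p \<in> (\<lambda>u. u * monomial t c) ` poly_in Z"
  then obtain u where u: "p = u * monomial t c" "keys u \<subseteq> {s. keys s \<subseteq> Z}"
    by (auto simp: poly_in_eq_monomial_space monomial_space_def)
  have "keys p \<subseteq> cone t Z"
    unfolding u(1) cone_def keys_mult_monomial[OF assms] using u(2) by (rule image_mono)
  then show "p \<in> monomial_space (cone t Z)" by (simp add: monomial_space_def)
next
  fix p :: "'k mpoly" assume "p \<in> monomial_space (cone t Z)"
  then have p: "\<exists>s. keys s \<subseteq> Z \<and> v = s + t" if "v \<in> keys p" for v
    using that by (auto simp: monomial_space_def cone_def)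
  define u where "u = (\<Sum>v\<in>keys p. monomial (v - t) (lookup p v / c))"
  have "u \<in> poly_in Z"
    unfolding u_def poly_in_eq_monomial_space
    by (rule monomial_space_sum) (use p in fastforce)
  moreover have "u * monomial t c = p"
  proof -
    have "u * monomial t c = (\<Sum>v\<in>keys p. monomial v (lookup p v))"
      unfolding u_def sum_distrib_right
    proof (rule sum.cong)
      fix v assume "v \<in> keys p"
      with p have "v - t + t = v" by fastforce
      with assms show "monomial (v - t) (lookup p v / c) * monomial t c = monomial v (lookup p v)"
        by (simp add: mult_single)
    qed simp
    then show ?thesis by (simp add: sum_monomials)
  qed
  ultimately show "p \<in> (\<lambda>u. u * monomial t c) ` poly_in Z" by blast
qed

context monomial_quotient
begin

lemma poly_in_carrier: "Z \<subseteq> {1..n} \<Longrightarrow> u \<in> poly_in Z \<Longrightarrow> u \<in> carrier R"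
  unfolding poly_in_eq_monomial_space using monomial_space_mono[of "{t. keys t \<subseteq> Z}" "{t. keys t \<subseteq> {1..n}}"] by auto

lemma monomial_I: "t \<in> EI \<Longrightarrow> monomial t c \<in> I"
  by (simp add: I_def)

lemma monomial_J_iff: "monomial t c \<in> J \<longleftrightarrow> c = 0 \<or> t \<in> EJ"
  by (simp add: J_def)

lemma J_iff: "f \<in> J \<longleftrightarrow> (\<forall>t. t \<notin> EJ \<longrightarrow> lookup f t = 0)"
  by (simp add: J_def monomial_space_iff)

lemma smult_monomial_coset:
  assumes "Z \<subseteq> {1..n}" "t \<in> EI" "u \<in> poly_in Z"
  shows "u \<odot>\<^bsub>M\<^esub> coset (monomial t c) = coset (u * monomial t c)"
  using assms by (intro smult_M poly_in_carrier[of Z] I_carrier monomial_I)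

lemma stanley_space_eq:
  assumes "Z \<subseteq> {1..n}" "t \<in> EI" "c \<noteq> 0"
  shows "stanley_space M (coset (monomial t c)) Z = coset ` monomial_space (cone t Z)"
proof -
  have "stanley_space M (coset (monomial t c)) Z = (\<lambda>u. coset (u * monomial t c)) ` poly_in Z"
    unfolding stanley_space_def using assms(1,2) by (intro image_cong refl smult_monomial_coset)
  then show ?thesis
    by (simp add: mult_monomial_image_poly_in[OF assms(3), symmetric] image_image)
qed

text \<open>Freeness of a summand \<open>x\<^sup>t K[Z]\<close> of \<open>I/J\<close> means that no monomial of the cone is killed by passing
to the quotient.\<close>

lemma inj_on_smult_monomial_iff:
  assumes "Z \<subseteq> {1..n}" "t \<in> EI" "c \<noteq> 0"
  shows "inj_on (\<lambda>u. u \<odot>\<^bsub>M\<^esub> coset (monomial t c)) (poly_in Z) \<longleftrightarrow> cone t Z \<inter> EJ = {}"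
proof -
  have eq: "u \<odot>\<^bsub>M\<^esub> coset (monomial t c) = v \<odot>\<^bsub>M\<^esub> coset (monomial t c) \<longleftrightarrow> (u - v) * monomial t c \<in> J"
    if "u \<in> poly_in Z" "v \<in> poly_in Z" for u v
    using that assms(1,2) by (simp add: smult_monomial_coset coset_eq_iff left_diff_distrib)
  show ?thesis
  proof
    assume inj: "inj_on (\<lambda>u. u \<odot>\<^bsub>M\<^esub> coset (monomial t c)) (poly_in Z)"
    show "cone t Z \<inter> EJ = {}"
    proof (rule ccontr)
      assume "cone t Z \<inter> EJ \<noteq> {}"
      then obtain s where s: "keys s \<subseteq> Z" "s + t \<in> EJ" by (auto simp: cone_def)
      then have "monomial s (1 :: 'k) \<in> poly_in Z" "0 \<in> (poly_in Z :: 'k mpoly set)"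
        by (simp_all add: poly_in_eq_monomial_space)
      moreover from this have "monomial s 1 \<odot>\<^bsub>M\<^esub> coset (monomial t c) = 0 \<odot>\<^bsub>M\<^esub> coset (monomial t c)"
        using s(2) by (simp add: eq monomial_J_iff mult_single add.commute)
      ultimately have "monomial s (1 :: 'k) = 0" using inj by (meson inj_onD)
      then show False by (metis lookup_single_eq lookup_zero zero_neq_one)
    qed
  next
    assume disj: "cone t Z \<inter> EJ = {}"
    show "inj_on (\<lambda>u. u \<odot>\<^bsub>M\<^esub> coset (monomial t c)) (poly_in Z)"
    proof (rule inj_onI)
      fix u v :: "'k mpoly"
      assume uv: "u \<in> poly_in Z" "v \<in> poly_in Z"
        and "u \<odot>\<^bsub>M\<^esub> coset (monomial t c) = v \<odot>\<^bsub>M\<^esub> coset (monomial t c)"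
      then have "keys ((u - v) * monomial t c) \<subseteq> EJ"
        by (auto simp: eq J_iff in_keys_iff)
      moreover have "(u - v) * monomial t c \<in> monomial_space (cone t Z)"
        using uv unfolding mult_monomial_image_poly_in[OF assms(3), symmetric]
        by (auto simp: poly_in_eq_monomial_space monomial_space_minus)
      ultimately have "keys ((u - v) * monomial t c) = {}"
        using disj unfolding monomial_space_def by blast
      then have "keys (u - v) = {}" using assms(3) by (simp add: keys_mult_monomial)
      then have "u - v = 0" by (intro poly_mapping_eqI) (auto simp: in_keys_iff)
      then show "u = v" by simp
    qed
  qed
qed

text \<open>The homogeneous components are at most one-dimensional, so a homogeneous element is zero or the class
of a monomial up to a scalar.\<close>

lemma quot_grading_cases:
  assumes "w \<in> quot_grading n I J \<alpha>"
  shows "w = J \<or> (\<exists>t c. c \<noteq> 0 \<and> t \<in> EI \<and> w = coset (monomial t c))"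
proof -
  obtain f where f: "f \<in> I" "f \<in> poly_component n \<alpha>" "w = coset f"
    using assms by (auto simp: quot_grading_def)
  show ?thesis
  proof (cases "f = 0")
    case True
    then show ?thesis using f(3) by (simp add: coset_0)
  next
    case False
    then obtain t where t: "t \<in> keys f"
      by (metis all_not_in_conv in_keys_iff lookup_zero poly_mapping_eqI)
    have "s = t" if "s \<in> keys f" for s
    proof (rule poly_mapping_eqI)
      fix i show "lookup s i = lookup t i"
        using f(2) that t unfolding poly_component_def by (metis (mono_tags, lifting) mem_Collect_eq of_nat_eq_iff)
    qed
    then have "keys f = {t}" using t by blast
    then have "f = monomial t (lookup f t)" using sum_monomials[of f] by simp
    moreover have "t \<in> EI" using t f(1) by (auto simp: I_def monomial_space_def)
    moreover have "lookup f t \<noteq> 0" using t by (simp add: in_keys_iff)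
    ultimately show ?thesis using f(3) by metis
  qed
qed

lemma finsum_M_eq:
  assumes "finite X" "\<And>i. i \<in> X \<Longrightarrow> f i \<in> I" "\<And>i. i \<in> X \<Longrightarrow> c i = coset (f i)"
  shows "(\<Oplus>\<^bsub>M\<^esub>i\<in>X. c i) = coset (\<Sum>i\<in>X. f i)"
proof -
  interpret abelian_monoid M by (rule abelian_monoid_M)
  have "(\<Oplus>\<^bsub>M\<^esub>i\<in>X. c i) = (\<Oplus>\<^bsub>M\<^esub>i\<in>X. coset (f i))"
    using assms by (intro finsum_cong') (auto simp: coset_in_M)
  then show ?thesis using finsum_M[OF assms(1,2)] by simp
qed

text \<open>A monomial of \<open>I/J\<close> has a component in some summand that contains its exponent. If two cones shared
an exponent, the class of the monomial would be a sum of components in two different ways.\<close>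

lemma stanley_decomposition_cones:
  assumes D: "is_stanley_decomposition n M (quot_grading n I J) D"
  obtains \<tau> where
    "\<And>i. i < length D \<Longrightarrow> cone (\<tau> i) (snd (D ! i)) \<subseteq> EI - EJ"
    "\<And>t. t \<in> EI - EJ \<Longrightarrow> \<exists>i<length D. t \<in> cone (\<tau> i) (snd (D ! i))"
    "\<And>i j t. i < length D \<Longrightarrow> j < length D \<Longrightarrow> t \<in> cone (\<tau> i) (snd (D ! i)) \<Longrightarrow>
      t \<in> cone (\<tau> j) (snd (D ! j)) \<Longrightarrow> i = j"
proof -
  let ?X = "{..<length D}"
  let ?Z = "\<lambda>i. snd (D ! i)"
  have Z: "?Z i \<subseteq> {1..n}" if "i < length D" for i
    using D nth_mem[OF that] unfolding is_stanley_decomposition_def by (auto simp: case_prod_beta)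
  have "\<exists>t c. c \<noteq> 0 \<and> t \<in> EI \<and> fst (D ! i) = coset (monomial t c) \<and> cone t (?Z i) \<inter> EJ = {}"
    if i: "i < length D" for i
  proof -
    from D nth_mem[OF i] obtain \<alpha> where \<alpha>: "fst (D ! i) \<in> quot_grading n I J \<alpha>"
      and inj: "inj_on (\<lambda>u. u \<odot>\<^bsub>M\<^esub> fst (D ! i)) (poly_in (?Z i))"
      unfolding is_stanley_decomposition_def by (auto simp: case_prod_beta)
    have one: "(0 :: 'k mpoly) \<in> poly_in (?Z i)" "(1 :: 'k mpoly) \<in> poly_in (?Z i)"
      by (simp_all add: poly_in_eq_monomial_space one_in_poly_in)
    have "fst (D ! i) \<noteq> J"
    proof
      assume "fst (D ! i) = J"
      then have "1 \<odot>\<^bsub>M\<^esub> fst (D ! i) = 0 \<odot>\<^bsub>M\<^esub> fst (D ! i)"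
        using smult_M[of 0 0] smult_M[of 1 0] one_closed zero_closed
        by (simp add: coset_0)
      with inj one have "(1 :: 'k mpoly) = 0" by (meson inj_onD)
      then show False by simp
    qed
    then obtain t c where "c \<noteq> 0" "t \<in> EI" "fst (D ! i) = coset (monomial t c)"
      using quot_grading_cases[OF \<alpha>] by blast
    with inj inj_on_smult_monomial_iff[OF Z[OF i]] show ?thesis by metis
  qed
  then obtain \<tau> \<gamma> where \<tau>: "\<And>i. i < length D \<Longrightarrow> \<gamma> i \<noteq> 0 \<and> \<tau> i \<in> EI \<and>
      fst (D ! i) = coset (monomial (\<tau> i) (\<gamma> i)) \<and> cone (\<tau> i) (?Z i) \<inter> EJ = {}"
    by metis
  have space: "stanley_space M (fst (D ! i)) (?Z i) = coset ` monomial_space (cone (\<tau> i) (?Z i))"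
    if "i < length D" for i
    using \<tau>[OF that] stanley_space_eq[OF Z[OF that]] by metis
  have unique: "\<exists>!c. c \<in> (\<Pi>\<^sub>E i\<in>?X. stanley_space M (fst (D ! i)) (?Z i)) \<and> v = (\<Oplus>\<^bsub>M\<^esub>i\<in>?X. c i)"
    if "v \<in> carrier M" for v
    using D[unfolded is_stanley_decomposition_def, THEN conjunct2] that by (rule bspec)
  have sub: "cone (\<tau> i) (?Z i) \<subseteq> EI - EJ" if i: "i < length D" for i
  proof -
    have "s + \<tau> i \<in> EI" if "keys s \<subseteq> ?Z i" for s
      using \<tau>[OF i] that Z[OF i] by (intro EI_up) auto
    then have "cone (\<tau> i) (?Z i) \<subseteq> EI" by (auto simp: cone_def)
    with \<tau>[OF i] show ?thesis by blast
  qed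
  show ?thesis
  proof (rule that[OF sub])
    fix t assume t: "t \<in> EI - EJ"
    obtain c where c: "c \<in> (\<Pi>\<^sub>E i\<in>?X. stanley_space M (fst (D ! i)) (?Z i))"
      and v: "coset (monomial t 1) = (\<Oplus>\<^bsub>M\<^esub>i\<in>?X. c i)"
      using unique[OF coset_in_M[OF monomial_I[of t 1]]] t by blast
    have "\<exists>g. g \<in> monomial_space (cone (\<tau> i) (?Z i)) \<and> c i = coset g" if "i \<in> ?X" for i
      using c that space by (auto simp: PiE_iff)
    then obtain g where g: "\<And>i. i \<in> ?X \<Longrightarrow> g i \<in> monomial_space (cone (\<tau> i) (?Z i)) \<and> c i = coset (g i)"
      by metis
    have "g i \<in> I" if "i \<in> ?X" for i
      using g[OF that] sub that monomial_space_mono[of "cone (\<tau> i) (?Z i)" EI] unfolding I_def by blast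
    then have "(\<Oplus>\<^bsub>M\<^esub>i\<in>?X. c i) = coset (\<Sum>i\<in>?X. g i)"
      using g by (intro finsum_M_eq) auto
    with v have "monomial t 1 - (\<Sum>i\<in>?X. g i) \<in> J" by (simp add: coset_eq_iff)
    with t have "lookup (monomial t 1 - (\<Sum>i\<in>?X. g i)) t = 0" by (simp add: J_iff)
    then have "(\<Sum>i\<in>?X. lookup (g i) t) \<noteq> 0" by (simp add: lookup_minus lookup_sum)
    then obtain i where "i \<in> ?X" "lookup (g i) t \<noteq> 0" by (meson sum.neutral)
    with g show "\<exists>i<length D. t \<in> cone (\<tau> i) (?Z i)"
      by (auto simp: monomial_space_iff)
  next
    fix i j t assume i: "i < length D" and j: "j < length D"
      and t: "t \<in> cone (\<tau> i) (?Z i)" "t \<in> cone (\<tau> j) (?Z j)"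
    \<comment> \<open>The decomposition of \<open>x\<^sup>t\<close> that places everything in summand \<open>i\<close>.\<close>
    define c where "c i = (\<lambda>k\<in>?X. coset (if k = i then monomial t (1::'k) else 0))" for i
    have tE: "t \<in> EI" "t \<notin> EJ" using sub[OF i] t by auto
    have c: "c i \<in> (\<Pi>\<^sub>E i\<in>?X. stanley_space M (fst (D ! i)) (?Z i)) \<and>
        coset (monomial t 1) = (\<Oplus>\<^bsub>M\<^esub>k\<in>?X. c i k)"
      if i: "i < length D" "t \<in> cone (\<tau> i) (?Z i)" for i
    proof
      show "c i \<in> (\<Pi>\<^sub>E i\<in>?X. stanley_space M (fst (D ! i)) (?Z i))"
        unfolding c_def using space i(2) by (intro PiE_I) auto
      have "(\<Oplus>\<^bsub>M\<^esub>k\<in>?X. c i k) = coset (\<Sum>k\<in>?X. if k = i then monomial t 1 else 0)"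
        using tE by (intro finsum_M_eq) (auto simp: c_def monomial_I zero_I)
      then show "coset (monomial t 1) = (\<Oplus>\<^bsub>M\<^esub>k\<in>?X. c i k)" using i(1) by simp
    qed
    have "c i = c j"
      using unique[OF coset_in_M[OF monomial_I[OF tE(1), of 1]]] c[OF i t(1)] c[OF j t(2)] by blast
    then have "c i i = c j i" by simp
    show "i = j"
    proof (rule ccontr)
      assume "i \<noteq> j"
      with \<open>c i i = c j i\<close> have "coset (monomial t 1) = coset 0" using i by (simp add: c_def)
      with tE(2) show False by (simp add: coset_eq_iff monomial_J_iff)
    qed
  qed
qed

text \<open>Conversely, the restrictions of \<open>f \<in> I\<close> to the cones are its components. They are unique because
different cones contain different monomials, all of them linearly independent modulo \<open>J\<close>.\<close>

lemma stanley_decomposition_of_cones: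
  assumes L: "\<And>t Z. (t, Z) \<in> set L \<Longrightarrow> Z \<subseteq> {1..n} \<and> cone t Z \<subseteq> EI - EJ"
    and part: "\<And>t. t \<in> EI - EJ \<Longrightarrow> \<exists>!i. i < length L \<and> t \<in> cone (fst (L ! i)) (snd (L ! i))"
  shows "is_stanley_decomposition n M (quot_grading n I J) (map (\<lambda>(t, Z). (coset (monomial t 1), Z)) L)"
    (is "is_stanley_decomposition n M _ ?D")
proof -
  let ?X = "{..<length L}"
  let ?C = "\<lambda>i. cone (fst (L ! i)) (snd (L ! i))"
  have LC: "snd (L ! i) \<subseteq> {1..n} \<and> ?C i \<subseteq> EI - EJ" if "i < length L" for i
    using L[of "fst (L ! i)" "snd (L ! i)"] nth_mem[OF that] by simp
  have tE: "t \<in> EI" "t \<notin> EJ" if "(t, Z) \<in> set L" for t Z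
    using L[OF that] apex_in_cone[of t Z] by blast+
  have space: "stanley_space M (fst (?D ! i)) (snd (?D ! i)) = coset ` monomial_space (?C i)"
    if i: "i < length L" for i
    using stanley_space_eq[of "snd (L ! i)" "fst (L ! i)" 1] LC[OF i] apex_in_cone[of "fst (L ! i)" "snd (L ! i)"] i
    by (simp add: case_prod_beta subset_iff)
  have C_I: "p \<in> I" if "p \<in> monomial_space (?C i)" "i < length L" for p i
    using that LC[OF that(2)] monomial_space_mono[of "?C i" EI] unfolding I_def by blast
  show ?thesis
    unfolding is_stanley_decomposition_def
  proof (intro conjI ballI; clarify?)
    fix w Z assume "(w, Z) \<in> set ?D"
    then obtain t where t: "(t, Z) \<in> set L" and w: "w = coset (monomial t 1)" by auto
    define \<alpha> where "\<alpha> = (\<lambda>i. int (lookup t i))"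
    have keys: "keys t \<subseteq> {1..n}" using tE(1)[OF t] EI_keys by auto
    have "\<alpha> \<in> Zn n" using keys by (auto simp: \<alpha>_def Zn_def in_keys_iff)
    moreover have "w \<in> quot_grading n I J \<alpha>"
      using tE(1)[OF t] keys unfolding quot_grading_def w
      by (intro imageI) (auto simp: monomial_I poly_component_def \<alpha>_def)
    ultimately show "w \<in> carrier M \<and> (\<exists>\<alpha>\<in>Zn n. w \<in> quot_grading n I J \<alpha>) \<and> Z \<subseteq> {1..n} \<and>
        inj_on (\<lambda>u. u \<odot>\<^bsub>M\<^esub> w) (poly_in Z)"
      using L[OF t] tE[OF t] w by (auto simp: coset_in_M monomial_I inj_on_smult_monomial_iff)
  next
    fix v assume "v \<in> carrier M"
    then obtain f where f: "f \<in> I" "v = coset f" by (auto simp: carrier_M)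
    define c where "c = (\<lambda>i\<in>?X. coset (restriction (?C i) f))"
    have restr: "restriction E f \<in> monomial_space E" for E
      by (simp add: monomial_space_iff lookup_restriction)
    have "f - (\<Sum>i\<in>?X. restriction (?C i) f) \<in> J"
      unfolding J_def monomial_space_iff
    proof (intro allI impI)
      fix t assume tJ: "t \<notin> EJ"
      show "lookup (f - (\<Sum>i\<in>?X. restriction (?C i) f)) t = 0"
      proof (cases "t \<in> EI")
        case False
        then have "lookup f t = 0" using f(1) by (simp add: I_def monomial_space_iff)
        then show ?thesis by (simp add: lookup_minus lookup_sum lookup_restriction cong: if_cong)
      next
        case True
        with part[of t] tJ obtain i where i: "i < length L" "t \<in> ?C i"
          and uniq: "\<And>j. j < length L \<Longrightarrow> t \<in> ?C j \<Longrightarrow> j = i" by blast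
        have "(\<Sum>j\<in>?X. lookup (restriction (?C j) f) t) = (\<Sum>j\<in>?X. if j = i then lookup f t else 0)"
        proof (rule sum.cong)
          fix j assume "j \<in> ?X"
          then have "t \<in> ?C j \<longleftrightarrow> j = i" using uniq[of j] i by blast
          then show "lookup (restriction (?C j) f) t = (if j = i then lookup f t else 0)"
            by (simp add: lookup_restriction)
        qed simp
        with i(1) show ?thesis by (simp add: lookup_minus lookup_sum)
      qed
    qed
    then have "v = coset (\<Sum>i\<in>?X. restriction (?C i) f)" by (simp add: f(2) coset_eq_iff)
    also have "\<dots> = (\<Oplus>\<^bsub>M\<^esub>i\<in>?X. c i)"
      using restr C_I by (intro finsum_M_eq[symmetric]) (auto simp: c_def)
    finally have v: "v = (\<Oplus>\<^bsub>M\<^esub>i\<in>?X. c i)" .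
    have c: "c \<in> (\<Pi>\<^sub>E i\<in>?X. stanley_space M (fst (?D ! i)) (snd (?D ! i)))"
      unfolding c_def using restr space by (intro PiE_I) (auto simp del: nth_map)
    have unique: "c1 = c2"
      if c1: "c1 \<in> (\<Pi>\<^sub>E i\<in>?X. stanley_space M (fst (?D ! i)) (snd (?D ! i)))"
        and c2: "c2 \<in> (\<Pi>\<^sub>E i\<in>?X. stanley_space M (fst (?D ! i)) (snd (?D ! i)))"
        and eq: "(\<Oplus>\<^bsub>M\<^esub>i\<in>?X. c1 i) = (\<Oplus>\<^bsub>M\<^esub>i\<in>?X. c2 i)" for c1 c2
    proof -
      have rep: "\<exists>g. \<forall>i\<in>?X. g i \<in> monomial_space (?C i) \<and> c i = coset (g i)"
        if "c \<in> (\<Pi>\<^sub>E i\<in>?X. stanley_space M (fst (?D ! i)) (snd (?D ! i)))" for c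
      proof (rule bchoice, rule ballI)
        fix i assume "i \<in> ?X"
        with that space show "\<exists>g. g \<in> monomial_space (?C i) \<and> c i = coset g"
          by (auto simp: PiE_iff simp del: nth_map)
      qed
      obtain g1 where g1: "\<And>i. i \<in> ?X \<Longrightarrow> g1 i \<in> monomial_space (?C i) \<and> c1 i = coset (g1 i)"
        using rep[OF c1] by blast
      obtain g2 where g2: "\<And>i. i \<in> ?X \<Longrightarrow> g2 i \<in> monomial_space (?C i) \<and> c2 i = coset (g2 i)"
        using rep[OF c2] by blast
      have "g1 i \<in> I" "g2 i \<in> I" if "i \<in> ?X" for i
        using g1[OF that] g2[OF that] C_I that by auto
      then have "(\<Oplus>\<^bsub>M\<^esub>i\<in>?X. c1 i) = coset (\<Sum>i\<in>?X. g1 i)" "(\<Oplus>\<^bsub>M\<^esub>i\<in>?X. c2 i) = coset (\<Sum>i\<in>?X. g2 i)"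
        using g1 g2 finsum_M_eq[of ?X g1 c1] finsum_M_eq[of ?X g2 c2] by auto
      with eq have diff: "(\<Sum>i\<in>?X. g1 i) - (\<Sum>i\<in>?X. g2 i) \<in> J" by (simp add: coset_eq_iff)
      have "g1 i = g2 i" if i: "i \<in> ?X" for i
      proof (rule poly_mapping_eqI)
        fix t
        show "lookup (g1 i) t = lookup (g2 i) t"
        proof (cases "t \<in> ?C i")
          case False
          then show ?thesis using g1[OF i] g2[OF i] by (simp add: monomial_space_iff)
        next
          case True
          then have t: "t \<in> EI - EJ" using LC i by blast
          have other: "t \<notin> ?C j" if "j \<in> ?X" "j \<noteq> i" for j
            using part[OF t] True i that by blast
          have single: "(\<Sum>j\<in>?X. lookup (g j) t) = lookup (g i) t"
            if g: "\<And>j. j \<in> ?X \<Longrightarrow> g j \<in> monomial_space (?C j)" for g :: "nat \<Rightarrow> 'k mpoly"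
          proof -
            have "(\<Sum>j\<in>?X. lookup (g j) t) = (\<Sum>j\<in>?X. if j = i then lookup (g i) t else 0)"
              using g other by (intro sum.cong) (auto simp: monomial_space_iff)
            then show ?thesis using i by simp
          qed
          have "lookup ((\<Sum>j\<in>?X. g1 j) - (\<Sum>j\<in>?X. g2 j)) t = 0"
            using diff t by (simp add: J_iff)
          with single[of g1] single[of g2] g1 g2 show ?thesis by (simp add: lookup_minus lookup_sum)
        qed
      qed
      then have "c1 i = c2 i" if "i \<in> ?X" for i using g1 g2 that by simp
      with c1 c2 show ?thesis by (intro PiE_ext) auto
    qed
    show "\<exists>!c. c \<in> (\<Pi>\<^sub>E i\<in>{..<length ?D}. stanley_space M (fst (?D ! i)) (snd (?D ! i))) \<and>
        v = (\<Oplus>\<^bsub>M\<^esub>i\<in>{..<length ?D}. c i)"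
      unfolding length_map using v c unique by (intro ex1I[of _ c]) auto
  qed
qed

end

section \<open>Socle monomials bound the depth\<close>

context monomial_quotient
begin

lemma zero_in_M: "J \<in> carrier M"
  using coset_in_M[OF zero_I] by (simp add: coset_0)

lemma smult_closed_M: "u \<in> carrier R \<Longrightarrow> v \<in> carrier M \<Longrightarrow> u \<odot>\<^bsub>M\<^esub> v \<in> carrier M"
  using mult_I I_carrier by (auto simp: carrier_M smult_M simp del: poly_ring_simps(1))

lemma list_smult_Nil: "list_smult M [] = {J}"
proof -
  interpret abelian_monoid M by (rule abelian_monoid_M)
  show ?thesis by (auto simp: list_smult_def zero_M)
qed

lemma list_smult_single:
  assumes "f \<in> carrier R"
  shows "list_smult M [f] = (\<lambda>v. f \<odot>\<^bsub>M\<^esub> v) ` carrier M"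
proof -
  interpret abelian_monoid M by (rule abelian_monoid_M)
  have sum: "(\<Oplus>\<^bsub>M\<^esub>j\<in>{..<length [f]}. ([f] ! j) \<odot>\<^bsub>M\<^esub> v j) = f \<odot>\<^bsub>M\<^esub> v 0" if "v 0 \<in> carrier M" for v
    using smult_closed_M[OF assms that] by (simp add: lessThan_Suc)
  show ?thesis
  proof (intro equalityI subsetI)
    fix x assume "x \<in> list_smult M [f]"
    then obtain v where "v \<in> {..<length [f]} \<rightarrow> carrier M"
      "x = (\<Oplus>\<^bsub>M\<^esub>j\<in>{..<length [f]}. ([f] ! j) \<odot>\<^bsub>M\<^esub> v j)"
      unfolding list_smult_def by blast
    with sum[of v] show "x \<in> (\<lambda>v. f \<odot>\<^bsub>M\<^esub> v) ` carrier M" by auto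
  next
    fix x assume "x \<in> (\<lambda>v. f \<odot>\<^bsub>M\<^esub> v) ` carrier M"
    then obtain v where v: "v \<in> carrier M" "x = f \<odot>\<^bsub>M\<^esub> v" by blast
    then have "x = (\<Oplus>\<^bsub>M\<^esub>j\<in>{..<length [f]}. ([f] ! j) \<odot>\<^bsub>M\<^esub> (\<lambda>_. v) j)" using sum by simp
    with v(1) show "x \<in> list_smult M [f]"
      unfolding list_smult_def by (intro CollectI exI[of _ "\<lambda>_. v"]) auto
  qed
qed

lemma maximal_ideal_eq:
  "Idl\<^bsub>R\<^esub> (var ` {1..n}) = monomial_space (pure_power_exponents n {1..n} (\<lambda>_. 1))"
proof -
  have "{var i ^ 1 | i. i \<in> {1..n}} = (var ` {1..n} :: 'k mpoly set)" by auto
  with genideal_pure_powers[of "{1..n}" n "\<lambda>_. 1", where 'k = 'k] show ?thesis by simp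
qed

lemma maximal_ideal_carrier: "f \<in> Idl\<^bsub>R\<^esub> (var ` {1..n}) \<Longrightarrow> f \<in> carrier R"
  unfolding maximal_ideal_eq
  using monomial_space_mono[of "pure_power_exponents n {1..n} (\<lambda>_. 1)" "{t. keys t \<subseteq> {1..n}}"]
  by (auto simp: pure_power_exponents_def)

text \<open>Every monomial of an element of the graded maximal ideal is divisible by some variable.\<close>

lemma maximal_ideal_mult_monomial:
  assumes f: "f \<in> Idl\<^bsub>R\<^esub> (var ` {1..n})"
    and up: "\<And>s t. t \<in> E \<Longrightarrow> keys s \<subseteq> {1..n} \<Longrightarrow> s + t \<in> E"
    and w: "\<And>i. i \<in> {1..n} \<Longrightarrow> monomial i 1 + w \<in> E"
  shows "f * monomial w c \<in> monomial_space E"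
proof (rule monomial_space_mult[where E = "pure_power_exponents n {1..n} (\<lambda>_. 1)" and E' = "{w}"])
  show "f \<in> monomial_space (pure_power_exponents n {1..n} (\<lambda>_. 1))"
    using f unfolding maximal_ideal_eq .
  show "monomial w c \<in> monomial_space {w}" by simp
  fix t v assume t: "t \<in> pure_power_exponents n {1..n} (\<lambda>_. 1)" and "v \<in> {w}"
  then obtain i where i: "i \<in> {1..n}" "1 \<le> lookup t i" and keys: "keys t \<subseteq> {1..n}"
    by (auto simp: pure_power_exponents_def)
  define s where "s = t - monomial i 1"
  have t_eq: "t = s + monomial i 1"
    using i(2) by (intro poly_mapping_eqI) (auto simp: s_def lookup_add lookup_minus lookup_single when_def)
  then have "keys s \<subseteq> {1..n}" using keys by (simp add: keys_add_nat)
  with w[OF i(1)] have "s + (monomial i 1 + w) \<in> E" by (rule up)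
  with t_eq \<open>v \<in> {w}\<close> show "t + v \<in> E" by (simp add: add.assoc)
qed

lemma depth_le:
  assumes "\<And>fs. set fs \<subseteq> Idl\<^bsub>R\<^esub> (var ` {1..n}) \<Longrightarrow> regular_sequence R M fs \<Longrightarrow> length fs \<le> d"
  shows "depth n M \<le> enat d"
  unfolding depth_def by (rule Sup_least) (use assms in auto)

lemma depth_eq_0_if_trivial:
  assumes "EI = EJ"
  shows "depth n M = 0"
proof -
  have M: "carrier M = {J}"
  proof -
    have "I = J" using assms by (simp add: I_def J_def)
    then have "v = J" if "v \<in> carrier M" for v
      using that coset_eq_J_iff unfolding carrier_M by blast
    with zero_in_M show ?thesis by blast
  qed
  have False if fs: "set fs \<subseteq> Idl\<^bsub>R\<^esub> (var ` {1..n})" "regular_sequence R M fs" for fs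
  proof -
    interpret abelian_monoid M by (rule abelian_monoid_M)
    have carr: "fs ! j \<in> carrier R" if "j < length fs" for j
      using fs(2) that unfolding regular_sequence_def by (meson nth_mem subsetD)
    have sum: "(\<Oplus>\<^bsub>M\<^esub>j\<in>{..<length fs}. (fs ! j) \<odot>\<^bsub>M\<^esub> v j) = J" if "v \<in> {..<length fs} \<rightarrow> carrier M" for v
    proof -
      have "(\<Oplus>\<^bsub>M\<^esub>j\<in>{..<length fs}. (fs ! j) \<odot>\<^bsub>M\<^esub> v j) \<in> carrier M"
        using carr that smult_closed_M by (intro finsum_closed) (auto simp: Pi_iff)
      then show ?thesis by (simp add: M)
    qed
    have "list_smult M fs = {J}"
    proof (intro equalityI subsetI)
      fix x assume "x \<in> list_smult M fs"
      then show "x \<in> {J}" using sum unfolding list_smult_def by auto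
    next
      have J: "(\<lambda>_. J) \<in> {..<length fs} \<rightarrow> carrier M" by (simp add: M)
      fix x assume "x \<in> {J}"
      then show "x \<in> list_smult M fs"
        unfolding list_smult_def using sum[OF J] J by (intro CollectI exI[of _ "\<lambda>_. J"]) simp
    qed
    with fs(2) M show False by (simp add: regular_sequence_def)
  qed
  then have "depth n M \<le> enat 0" by (intro depth_le) blast
  then show ?thesis by (simp add: zero_enat_def[symmetric])
qed

text \<open>Every element of the graded maximal ideal kills the nonzero class of \<open>x\<^sup>w\<close>, hence is a zero divisor.\<close>

lemma depth_eq_0_if_socle:
  assumes w: "w \<in> EI" "w \<notin> EJ" "\<And>i. i \<in> {1..n} \<Longrightarrow> monomial i 1 + w \<in> EJ"
  shows "depth n M = 0"
proof -
  have "length fs \<le> 0" if fs: "set fs \<subseteq> Idl\<^bsub>R\<^esub> (var ` {1..n})" "regular_sequence R M fs" for fs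
  proof (rule ccontr)
    assume "\<not> length fs \<le> 0"
    then have len: "0 < length fs" by simp
    then have f: "fs ! 0 \<in> Idl\<^bsub>R\<^esub> (var ` {1..n})" using fs(1) by (meson nth_mem subsetD)
    let ?v = "coset (monomial w (1 :: 'k))"
    have v: "?v \<in> carrier M" using w(1) by (intro coset_in_M monomial_I)
    have "fs ! 0 * monomial w 1 \<in> J"
      unfolding J_def using f EJ_up w(3) by (rule maximal_ideal_mult_monomial)
    then have "(fs ! 0) \<odot>\<^bsub>M\<^esub> ?v = J"
      using maximal_ideal_carrier[OF f] I_carrier[OF monomial_I[OF w(1)]] by (simp add: smult_M coset_eq_J_iff del: poly_ring_simps(1))
    then have "?v \<in> list_smult M (take 0 fs)"
      using fs(2) len v unfolding regular_sequence_def by (metis list_smult_Nil singletonI take0)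
    then have "monomial w (1 :: 'k) \<in> J" by (simp add: list_smult_Nil coset_eq_J_iff)
    with w(2) show False by (simp add: monomial_J_iff)
  qed
  then have "depth n M \<le> enat 0" by (rule depth_le)
  then show ?thesis by (simp add: zero_enat_def[symmetric])
qed

text \<open>Here \<open>x\<^sup>w\<close> represents a socle element of \<open>S/I\<close>, which forces the depth of \<open>I/J\<close> to be at most \<open>1\<close>
as soon as \<open>I\<close> contains a monomial \<open>x\<^sup>u\<close> that is regular on \<open>S/J\<close>. Instead of the long exact sequence for
\<open>0 \<rightarrow> I/J \<rightarrow> S/J \<rightarrow> S/I \<rightarrow> 0\<close>, the proof exhibits the failure of regularity: if \<open>f, g\<close> is regular, then
\<open>g (f x\<^sup>w) = f (g x\<^sup>w) \<in> f I\<close> gives \<open>f x\<^sup>w = f h\<close> modulo \<open>J\<close> with \<open>h \<in> I\<close>, and cancelling \<open>f\<close> gives \<open>x\<^sup>w \<in> I\<close>.\<close>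

lemma depth_le_1_if_socle:
  assumes w: "w \<notin> EI" "keys w \<subseteq> {1..n}" "\<And>i. i \<in> {1..n} \<Longrightarrow> monomial i 1 + w \<in> EI"
    and u: "u \<in> EI" "\<And>t. t + u \<in> EJ \<Longrightarrow> t \<in> EJ"
  shows "depth n M \<le> 1"
proof -
  have "length fs \<le> 1" if fs: "set fs \<subseteq> Idl\<^bsub>R\<^esub> (var ` {1..n})" "regular_sequence R M fs" for fs
  proof (rule ccontr)
    assume "\<not> length fs \<le> 1"
    then have len: "0 < length fs" "1 < length fs" by linarith+
    define f g where "f = fs ! 0" and "g = fs ! 1"
    have fg: "f \<in> Idl\<^bsub>R\<^esub> (var ` {1..n})" "g \<in> Idl\<^bsub>R\<^esub> (var ` {1..n})"
      using fs(1) len nth_mem unfolding f_def g_def by blast+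
    note carr = fg[THEN maximal_ideal_carrier]
    have take: "take 0 fs = []" "take 1 fs = [f]"
      using len by (simp_all add: f_def take_Suc_conv_app_nth)
    have reg_f: "v = J" if "v \<in> carrier M" "f \<odot>\<^bsub>M\<^esub> v = J" for v
      using fs(2) len(1) that take(1) unfolding regular_sequence_def f_def by (metis list_smult_Nil singletonD singletonI)
    have reg_g: "v \<in> list_smult M [f]" if "v \<in> carrier M" "g \<odot>\<^bsub>M\<^esub> v \<in> list_smult M [f]" for v
      using fs(2) len(2) that take(2) unfolding regular_sequence_def g_def by metis
    \<comment> \<open>The element \<open>f\<close> is regular on \<open>S/J\<close> and not only on \<open>I/J\<close>, since multiplication by \<open>x\<^sup>u\<close> embeds \<open>S/J\<close> into \<open>I/J\<close>.\<close>
    have regular: "y \<in> J" if y: "y \<in> carrier R" "f * y \<in> J" for y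
    proof -
      have yu: "y * monomial u 1 \<in> I" using mult_I[OF y(1) monomial_I[OF u(1), of 1]] .
      have "f * (y * monomial u 1) = monomial u 1 * (f * y)" by (simp add: algebra_simps)
      also have "\<dots> \<in> J" using I_carrier[OF monomial_I[OF u(1)]] y(2) by (rule mult_J)
      finally have "f \<odot>\<^bsub>M\<^esub> coset (y * monomial u 1) = J"
        using carr(1) I_carrier[OF yu] by (simp add: smult_M coset_eq_J_iff del: poly_ring_simps(1))
      then have "coset (y * monomial u 1) = J" by (rule reg_f[OF coset_in_M[OF yu]])
      then have "y * monomial u 1 \<in> J" by (simp add: coset_eq_J_iff)
      then have "(\<lambda>s. s + u) ` keys y \<subseteq> EJ"
        by (simp add: J_def monomial_space_def keys_mult_monomial)
      then show "y \<in> J" using u(2) by (auto simp: J_def monomial_space_def)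
    qed
    let ?w = "monomial w (1 :: 'k)"
    have w_carr: "?w \<in> carrier R" using w(2) by simp
    have fw: "f * ?w \<in> I" and gw: "g * ?w \<in> I"
      unfolding I_def using fg EI_up w(3) by (auto intro: maximal_ideal_mult_monomial)
    have "g \<odot>\<^bsub>M\<^esub> coset (f * ?w) = f \<odot>\<^bsub>M\<^esub> coset (g * ?w)"
      using carr I_carrier[OF fw] I_carrier[OF gw] by (simp add: smult_M algebra_simps del: poly_ring_simps(1))
    then have "g \<odot>\<^bsub>M\<^esub> coset (f * ?w) \<in> list_smult M [f]"
      using coset_in_M[OF gw] by (simp add: list_smult_single[OF carr(1)])
    then have "coset (f * ?w) \<in> list_smult M [f]" by (rule reg_g[OF coset_in_M[OF fw]])
    then obtain h where h: "h \<in> I" "coset (f * ?w) = f \<odot>\<^bsub>M\<^esub> coset h"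
      unfolding list_smult_single[OF carr(1)] carrier_M by blast
    then have "f * ?w - f * h \<in> J"
      using smult_M[OF carr(1) I_carrier[OF h(1)]] by (simp add: coset_eq_iff)
    moreover have "?w - h \<in> carrier R"
      using w_carr I_carrier[OF h(1)] by (simp add: monomial_space_minus)
    ultimately have "?w - h \<in> J" using regular by (simp add: right_diff_distrib)
    then have "(?w - h) + h \<in> I" using J_subset_I h(1) by (intro add_I) auto
    with w(1) show False by (simp add: I_def)
  qed
  then have "depth n M \<le> enat 1" by (rule depth_le)
  then show ?thesis by (simp add: one_enat_def)
qed

end

section \<open>Quotients of ideals generated by pure powers\<close>

definition vec :: "nat \<Rightarrow> (nat \<Rightarrow> nat) \<Rightarrow> (nat \<Rightarrow>\<^sub>0 nat)" where
  "vec n f = (\<Sum>i\<in>{1..n}. monomial i (f i))"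

lemma lookup_vec: "lookup (vec n f) i = (if i \<in> {1..n} then f i else 0)"
proof -
  have "lookup (vec n f) i = (\<Sum>j\<in>{1..n}. if j = i then f j else 0)"
    unfolding vec_def lookup_sum by (rule sum.cong) (auto simp: lookup_single when_def)
  then show ?thesis by simp
qed

lemma keys_vec: "keys (vec n f) \<subseteq> {1..n}"
  by (auto simp: in_keys_iff lookup_vec split: if_splits)

text \<open>An antisymmetric relation and its converse overlap in the diagonal only.\<close>

lemma card_antisym_le:
  assumes "finite P" "r \<subseteq> P \<times> P" "antisym r"
  shows "2 * card r \<le> card P * card P + card P"
proof -
  have fin: "finite r" "finite (r\<inverse>)" using assms(1,2) by (auto intro: finite_subset)
  have "2 * card r = card r + card (r\<inverse>)" by simp
  also have "\<dots> = card (r \<union> r\<inverse>) + card (r \<inter> r\<inverse>)" using fin by (rule card_Un_Int)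
  also have "card (r \<union> r\<inverse>) \<le> card (P \<times> P)"
    using assms(1,2) by (intro card_mono) auto
  also have "card (r \<inter> r\<inverse>) \<le> card (Id_on P)"
    using assms by (intro card_mono) (auto simp: Id_on_def dest: antisymD)
  also have "card (Id_on P) = card P"
  proof -
    have "Id_on P = (\<lambda>x. (x, x)) ` P" by auto
    then show ?thesis by (simp add: card_image inj_on_def)
  qed
  finally show ?thesis by (simp add: card_cartesian_product)
qed

lemma finite_bounded_exponents:
  "finite {t :: nat \<Rightarrow>\<^sub>0 nat. keys t \<subseteq> {1..n} \<and> (\<forall>i. lookup t i \<le> c)}"
proof -
  have "finite {f. \<forall>i. (i \<in> {1..n} \<longrightarrow> f i \<in> {..c}) \<and> (i \<notin> {1..n} \<longrightarrow> f i = (0::nat))}"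
    by (rule finite_set_of_finite_funs) auto
  then have "finite (lookup ` {t. keys t \<subseteq> {1..n} \<and> (\<forall>i. lookup t i \<le> c)})"
    by (rule finite_subset[rotated]) (auto simp: in_keys_iff subset_iff)
  then show ?thesis by (rule finite_imageD) (auto intro: inj_onI poly_mapping_eqI)
qed

locale pure_power_quotient =
  fixes n m :: nat and a b :: "nat \<Rightarrow> nat" and I J :: "'k::field mpoly set"
  assumes m_le_n: "m \<le> n"
    and a_pos: "\<And>i. i \<in> {1..n} \<Longrightarrow> 1 \<le> a i"
    and a_le_b: "\<And>i. i \<in> {1..m} \<Longrightarrow> a i \<le> b i"
    and I_eq: "I = monomial_space (pure_power_exponents n {1..n} a)"
    and J_eq: "J = monomial_space (pure_power_exponents n {1..m} b)"
begin

abbreviation "EI \<equiv> pure_power_exponents n {1..n} a"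
abbreviation "EJ \<equiv> pure_power_exponents n {1..m} b"

sublocale monomial_quotient n EI EJ I J
proof
  show "EJ \<subseteq> EI"
  proof
    fix t assume "t \<in> EJ"
    then obtain i where i: "i \<in> {1..m}" "b i \<le> lookup t i" and t: "keys t \<subseteq> {1..n}"
      by (auto simp: pure_power_exponents_def)
    then have "i \<in> {1..n}" "a i \<le> lookup t i" using m_le_n a_le_b[of i] by auto
    with t show "t \<in> EI" unfolding pure_power_exponents_def by blast
  qed
qed (auto simp: I_eq J_eq pure_power_exponents_up, auto simp: pure_power_exponents_def)

abbreviation "P \<equiv> {m + 1..n}"

lemma card_P: "card P = n - m"
  by simp

lemma exponents_iff:
  "t \<in> EI - EJ \<longleftrightarrow> keys t \<subseteq> {1..n} \<and> (\<exists>i\<in>{1..n}. a i \<le> lookup t i) \<and> (\<forall>i\<in>{1..m}. lookup t i < b i)"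
  by (auto simp: pure_power_exponents_def not_le)

text \<open>The exponent of the monomial that spans the socle of \<open>S/I\<close>.\<close>

definition w :: "nat \<Rightarrow>\<^sub>0 nat" where
  "w = vec n (\<lambda>i. a i - 1)"

lemma w_less: "i \<in> {1..n} \<Longrightarrow> lookup w i < a i"
  using a_pos[of i] by (simp add: w_def lookup_vec)

lemma w_notin_EI: "w \<notin> EI"
  using w_less by (force simp: pure_power_exponents_def)

lemma w_keys: "keys w \<subseteq> {1..n}"
  unfolding w_def by (rule keys_vec)

lemma var_w_in_EI:
  assumes "i \<in> {1..n}"
  shows "monomial i 1 + w \<in> EI"
proof -
  have "keys (monomial i 1 + w) \<subseteq> {1..n}" using assms w_keys by (simp add: keys_add_nat)
  moreover have "a i \<le> lookup (monomial i 1 + w) i" using assms by (simp add: lookup_add w_def lookup_vec)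
  ultimately show ?thesis using assms unfolding pure_power_exponents_def by blast
qed

lemma var_w_exponent:
  assumes "j \<in> P"
  shows "monomial j 1 + w \<in> EI - EJ"
proof -
  have "lookup (monomial j 1 + w) i < b i" if "i \<in> {1..m}" for i
    using w_less[of i] a_le_b[OF that] that m_le_n assms
    by (auto simp: lookup_add lookup_single when_def)
  with var_w_in_EI[of j] assms show ?thesis by (auto simp: pure_power_exponents_def not_le)
qed

lemma cone_directions:
  assumes "Z \<subseteq> {1..n}" "cone t Z \<subseteq> EI - EJ"
  shows "Z \<subseteq> P"
proof
  fix j assume j: "j \<in> Z"
  show "j \<in> P"
  proof (rule ccontr)
    assume "j \<notin> P"
    then have jm: "j \<in> {1..m}" using assms(1) j by auto
    have "monomial j (b j) + t \<in> cone t Z" using j by (auto simp: cone_def)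
    then have "lookup (monomial j (b j) + t) j < b j"
      using assms(2) jm exponents_iff by blast
    then show False by (simp add: lookup_add)
  qed
qed

text \<open>The edges \<open>(j, l)\<close> of the relation \<open>r\<close> in the proof say that \<open>w + e\<^sub>j + e\<^sub>l\<close> lies in the cone of
\<open>w + e\<^sub>j\<close>. An edge in both directions would put \<open>w + e\<^sub>j\<close> and \<open>w + e\<^sub>l\<close> into the same cone.\<close>

lemma cones_upper_bound:
  fixes \<tau> :: "nat \<Rightarrow> nat \<Rightarrow>\<^sub>0 nat"
  assumes Z: "\<And>i. i \<in> X \<Longrightarrow> Z i \<subseteq> {1..n} \<and> d \<le> card (Z i)"
    and sub: "\<And>i. i \<in> X \<Longrightarrow> cone (\<tau> i) (Z i) \<subseteq> EI - EJ"
    and cover: "\<And>t. t \<in> EI - EJ \<Longrightarrow> \<exists>i\<in>X. t \<in> cone (\<tau> i) (Z i)"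
    and disj: "\<And>i j t. i \<in> X \<Longrightarrow> j \<in> X \<Longrightarrow> t \<in> cone (\<tau> i) (Z i) \<Longrightarrow> t \<in> cone (\<tau> j) (Z j) \<Longrightarrow> i = j"
    and "X \<noteq> {}"
  shows "2 * d \<le> n - m + 1"
proof (cases "P = {}")
  case True
  obtain i where i: "i \<in> X" using \<open>X \<noteq> {}\<close> by blast
  then have "Z i = {}" using cone_directions[OF _ sub[OF i]] Z[OF i] True by blast
  then show ?thesis using Z[OF i] by simp
next
  case False
  have ZP: "Z i \<subseteq> P" if "i \<in> X" for i
    using cone_directions[OF _ sub[OF that]] Z[OF that] by blast
  have "\<exists>i\<in>X. monomial j 1 + w \<in> cone (\<tau> i) (Z i)" if "j \<in> P" for j
    using cover var_w_exponent[OF that] by blast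
  then obtain f where f: "\<And>j. j \<in> P \<Longrightarrow> f j \<in> X \<and> monomial j 1 + w \<in> cone (\<tau> (f j)) (Z (f j))"
    by metis
  \<comment> \<open>Two vectors \<open>w + e\<^sub>j\<close> and \<open>w + e\<^sub>l\<close> in one cone have their meet \<open>w\<close> in it.\<close>
  have inj: "j = l" if jl: "j \<in> P" "l \<in> P" "f j = f l" for j l
  proof (rule ccontr)
    assume "j \<noteq> l"
    let ?C = "cone (\<tau> (f j)) (Z (f j))"
    have jC: "monomial j 1 + w \<in> ?C" and lC: "monomial l 1 + w \<in> ?C"
      using f[OF jl(1)] f[OF jl(2)] jl(3) by auto
    have "lookup (\<tau> (f j)) x \<le> lookup w x \<and> (x \<notin> Z (f j) \<longrightarrow> lookup w x = lookup (\<tau> (f j)) x)" for x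
    proof (cases "x = j")
      case True
      with \<open>j \<noteq> l\<close> have "lookup (monomial l 1 + w) x = lookup w x" by (simp add: lookup_add lookup_single)
      with lC show ?thesis unfolding cone_iff by metis
    next
      case False
      then have "lookup (monomial j 1 + w) x = lookup w x" by (simp add: lookup_add lookup_single)
      with jC show ?thesis unfolding cone_iff by metis
    qed
    then have "w \<in> ?C" by (simp add: cone_iff)
    with sub f[OF jl(1)] have "w \<in> EI" by blast
    with w_notin_EI show False by simp
  qed
  define r where "r = Sigma P (\<lambda>j. Z (f j))"
  have edge: "monomial l 1 + (monomial j 1 + w) \<in> cone (\<tau> (f j)) (Z (f j))" if "(j, l) \<in> r" for j l
  proof -
    have l: "l \<in> Z (f j)" and j: "j \<in> P" using that by (auto simp: r_def)
    show ?thesis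
      unfolding cone_iff
    proof (intro allI conjI impI)
      fix x
      have jC: "lookup (\<tau> (f j)) x \<le> lookup (monomial j 1 + w) x"
        "x \<notin> Z (f j) \<Longrightarrow> lookup (monomial j 1 + w) x = lookup (\<tau> (f j)) x"
        using f[OF j] unfolding cone_iff by blast+
      show "lookup (\<tau> (f j)) x \<le> lookup (monomial l 1 + (monomial j 1 + w)) x"
        using jC(1) unfolding lookup_add[of "monomial l 1"] by simp
      assume "x \<notin> Z (f j)"
      moreover from this l have "lookup (monomial l (1::nat)) x = 0" by (auto simp: lookup_single when_def)
      ultimately show "lookup (monomial l 1 + (monomial j 1 + w)) x = lookup (\<tau> (f j)) x"
        using jC(2) unfolding lookup_add[of "monomial l 1"] by simp
    qed
  qed
  have rP: "r \<subseteq> P \<times> P"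
  proof -
    have "Z (f j) \<subseteq> P" if "j \<in> P" for j using f[OF that] ZP by blast
    then show ?thesis unfolding r_def by blast
  qed
  have "antisym r"
  proof (rule antisymI)
    fix j l assume jl: "(j, l) \<in> r" "(l, j) \<in> r"
    then have P: "j \<in> P" "l \<in> P" by (auto simp: r_def)
    have "monomial l 1 + (monomial j 1 + w) = monomial j 1 + (monomial l 1 + w)" by (simp add: ac_simps)
    then have "f j = f l" using edge[OF jl(1)] edge[OF jl(2)] f[OF P(1)] f[OF P(2)] by (intro disj) auto
    with inj P show "j = l" by blast
  qed
  then have "2 * card r \<le> card P * card P + card P"
    using rP by (intro card_antisym_le) auto
  moreover have "card P * d \<le> card r"
  proof -
    have "finite (Z (f j))" if "j \<in> P" for j
      using f[OF that] ZP by (meson finite_atLeastAtMost finite_subset)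
    then have "card r = (\<Sum>j\<in>P. card (Z (f j)))"
      unfolding r_def by (intro card_SigmaI) auto
    also have "\<dots> \<ge> (\<Sum>j\<in>P. d)"
      using f Z by (intro sum_mono) auto
    finally show ?thesis by simp
  qed
  ultimately have "card P * (2 * d) \<le> card P * (card P + 1)" by (simp add: algebra_simps)
  moreover have "0 < card P" using False by (simp add: card_gt_0_iff)
  ultimately have "2 * d \<le> card P + 1" by (simp only: mult_le_cancel1)
  then show ?thesis by simp
qed

lemma decomposition_sdepth_le:
  assumes D: "is_stanley_decomposition n M (quot_grading n I J) D"
  shows "decomposition_sdepth D \<le> (n - m + 1) div 2"
proof (cases "D = []")
  case True
  then show ?thesis by (simp add: decomposition_sdepth_def)
next
  case False
  obtain \<tau> where \<tau>:
    "\<And>i. i < length D \<Longrightarrow> cone (\<tau> i) (snd (D ! i)) \<subseteq> EI - EJ"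
    "\<And>t. t \<in> EI - EJ \<Longrightarrow> \<exists>i<length D. t \<in> cone (\<tau> i) (snd (D ! i))"
    "\<And>i j t. i < length D \<Longrightarrow> j < length D \<Longrightarrow> t \<in> cone (\<tau> i) (snd (D ! i)) \<Longrightarrow>
      t \<in> cone (\<tau> j) (snd (D ! j)) \<Longrightarrow> i = j"
    by (rule stanley_decomposition_cones[OF D]) blast
  have Z: "snd (D ! i) \<subseteq> {1..n} \<and> decomposition_sdepth D \<le> card (snd (D ! i))" if "i \<in> {..<length D}" for i
  proof
    have mem: "D ! i \<in> set D" using that by simp
    with D show "snd (D ! i) \<subseteq> {1..n}"
      unfolding is_stanley_decomposition_def by (auto simp: case_prod_beta)
    show "decomposition_sdepth D \<le> card (snd (D ! i))"
      using False mem by (auto simp: decomposition_sdepth_def case_prod_beta intro!: Min_le)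
  qed
  have "2 * decomposition_sdepth D \<le> n - m + 1"
  proof (rule cones_upper_bound[OF Z])
    show "\<exists>i\<in>{..<length D}. t \<in> cone (\<tau> i) (snd (D ! i))" if "t \<in> EI - EJ" for t
      using \<tau>(2)[OF that] by blast
    show "i = j" if "i \<in> {..<length D}" "j \<in> {..<length D}"
      "t \<in> cone (\<tau> i) (snd (D ! i))" "t \<in> cone (\<tau> j) (snd (D ! j))" for i j t
      using \<tau>(3)[of i j t] that by simp
  qed (use \<tau>(1) False in auto)
  then show ?thesis by linarith
qed

text \<open>The partition is given by the map \<open>part\<close> that sends an exponent to the apex and the directions of its
cone; the first two properties say that the cones are exactly the fibres of this map.\<close>

lemma cone_partition_exists:
  obtains part where
    "\<And>t. t \<in> EI - EJ \<Longrightarrow> t \<in> cone (fst (part t)) (snd (part t))"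
    "\<And>t s. t \<in> EI - EJ \<Longrightarrow> s \<in> cone (fst (part t)) (snd (part t)) \<Longrightarrow> s \<in> EI - EJ \<and> part s = part t"
    "\<And>t. t \<in> EI - EJ \<Longrightarrow> snd (part t) \<subseteq> {1..n} \<and> n - m \<le> 2 * card (snd (part t))"
    "finite (part ` (EI - EJ))"
proof -
  obtain F where F: "interval_partition P F"
    using interval_partition_exists[of P] by auto
  have F1: "A \<noteq> {} \<and> A \<subseteq> B \<and> B \<subseteq> P \<and> n - m \<le> 2 * card B" if "(A, B) \<in> F" for A B
    using F that card_P unfolding interval_partition_def by auto
  have F2: "\<exists>!Q. Q \<in> F \<and> in_interval T Q" if "T \<subseteq> P" "T \<noteq> {}" for T
    using F that unfolding interval_partition_def by auto
  \<comment> \<open>If \<open>big t\<close>, then \<open>x\<^sup>t\<close> is in \<open>I\<close> because of its first \<open>m\<close> variables, so the empty support must be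
    covered too and \<open>P\<close> itself can be used as the direction set.\<close>
  define big where "big t \<longleftrightarrow> (\<exists>i\<in>{1..m}. a i \<le> lookup t i)" for t
  define G where "G t = (if big t then {({}, P)} else F)" for t
  define supp where "supp t = {i \<in> P. a i \<le> lookup t i}" for t
  define iv where "iv t = (THE Q. Q \<in> G t \<and> in_interval (supp t) Q)" for t
  \<comment> \<open>The apex is the least exponent that agrees with \<open>t\<close> outside \<open>B\<close> and whose support is at least \<open>A\<close>, for \<open>iv t = (A, B)\<close>.\<close>
  define part where "part t =
    (vec n (\<lambda>i. if i \<in> fst (iv t) then a i else if i \<in> snd (iv t) then 0 else lookup t i), snd (iv t))" for t
  have ex1: "\<exists>!Q. Q \<in> G t \<and> in_interval (supp t) Q" if t: "t \<in> EI - EJ" for t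
  proof (cases "big t")
    case True
    then show ?thesis by (intro ex1I[of _ "({}, P)"]) (auto simp: G_def supp_def)
  next
    case False
    obtain i where i: "i \<in> {1..n}" "a i \<le> lookup t i" using t unfolding exponents_iff by blast
    with False have "i \<notin> {1..m}" unfolding big_def by blast
    with i have "i \<in> supp t" by (auto simp: supp_def)
    then have "supp t \<noteq> {}" "supp t \<subseteq> P" by (auto simp: supp_def)
    with F2 False show ?thesis by (simp add: G_def)
  qed
  have iv: "iv t \<in> G t \<and> in_interval (supp t) (iv t)" if "t \<in> EI - EJ" for t
    unfolding iv_def using ex1[OF that] by (rule theI')
  have iv_eq: "iv t = Q" if "t \<in> EI - EJ" "Q \<in> G t" "in_interval (supp t) Q" for t Q
    using ex1[OF that(1)] iv[OF that(1)] that(2,3) by blast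
  have G: "fst Q \<subseteq> snd Q \<and> snd Q \<subseteq> P \<and> n - m \<le> 2 * card (snd Q) \<and> (big t \<or> fst Q \<noteq> {})"
    if "Q \<in> G t" for t Q
    using that F1[of "fst Q" "snd Q"] by (auto simp: G_def split: if_splits)
  have apex: "lookup (fst (part t)) i =
      (if i \<in> fst (iv t) then a i else if i \<in> snd (iv t) then 0 else lookup t i)"
    if t: "t \<in> EI - EJ" for t i
  proof (cases "i \<in> {1..n}")
    case True
    then show ?thesis by (simp add: part_def lookup_vec)
  next
    case False
    have "keys t \<subseteq> {1..n}" using t unfolding exponents_iff by blast
    with False have "lookup t i = 0" by (auto simp: in_keys_iff)
    moreover have "i \<notin> snd (iv t)" "i \<notin> fst (iv t)"
      using False G[of "iv t" t] iv[OF t] by auto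
    ultimately show ?thesis using False by (simp add: part_def lookup_vec)
  qed
  show ?thesis
  proof (rule that[of part])
    fix t assume t: "t \<in> EI - EJ"
    show "t \<in> cone (fst (part t)) (snd (part t))"
      using iv[OF t] G[of "iv t" t] apex[OF t]
      unfolding cone_iff by (auto simp: part_def supp_def)
    show "snd (part t) \<subseteq> {1..n} \<and> n - m \<le> 2 * card (snd (part t))"
      using iv[OF t] G[of "iv t" t] by (auto simp: part_def)
    fix s assume s: "s \<in> cone (fst (part t)) (snd (part t))"
    note ivt = iv[OF t] G[OF iv[OF t, THEN conjunct1]]
    have off: "lookup s i = lookup t i" if "i \<notin> snd (iv t)" for i
      using s that ivt apex[OF t, of i] unfolding cone_iff by (auto simp: part_def)
    have on: "a i \<le> lookup s i" if "i \<in> fst (iv t)" for i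
      using s that apex[OF t, of i] unfolding cone_iff by (metis)
    have off_m: "lookup s i = lookup t i" if "i \<in> {1..m}" for i
      using that ivt by (intro off) auto
    have big: "big s = big t" using off_m by (simp add: big_def)
    have "keys s \<subseteq> {1..n}"
    proof
      fix i assume i: "i \<in> keys s"
      show "i \<in> {1..n}"
      proof (rule ccontr)
        assume n: "i \<notin> {1..n}"
        then have "lookup s i = lookup t i" using ivt by (intro off) auto
        with i have "i \<in> keys t" by (simp add: in_keys_iff)
        with n t show False unfolding exponents_iff by blast
      qed
    qed
    moreover have "\<exists>i\<in>{1..n}. a i \<le> lookup s i"
    proof (cases "big t")
      case True
      then obtain i where "i \<in> {1..m}" "a i \<le> lookup s i" using big by (auto simp: big_def)
      with m_le_n show ?thesis by (intro bexI[of _ i]) auto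
    next
      case False
      with ivt obtain i where "i \<in> fst (iv t)" "i \<in> P" by blast
      with on show ?thesis by (intro bexI[of _ i]) auto
    qed
    moreover have "\<forall>i\<in>{1..m}. lookup s i < b i"
      using off_m t unfolding exponents_iff by simp
    ultimately have sE: "s \<in> EI - EJ" unfolding exponents_iff by blast
    have "in_interval (supp s) (iv t)"
    proof
      show "fst (iv t) \<subseteq> supp s" using on ivt by (auto simp: supp_def)
      show "supp s \<subseteq> snd (iv t)"
      proof
        fix i assume i: "i \<in> supp s"
        show "i \<in> snd (iv t)"
        proof (rule ccontr)
          assume ni: "i \<notin> snd (iv t)"
          with off i have "i \<in> supp t" by (simp add: supp_def)
          with ivt ni show False by blast
        qed
      qed
    qed
    then have "iv s = iv t"
      using ivt big by (intro iv_eq[OF sE]) (simp_all add: G_def)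
    moreover have "fst (part s) = fst (part t)"
      using \<open>iv s = iv t\<close> off by (intro poly_mapping_eqI) (simp add: apex[OF t] apex[OF sE])
    ultimately have "part s = part t" by (simp add: part_def)
    with sE show "s \<in> EI - EJ \<and> part s = part t" by blast
  next
    define c where "c = (\<Sum>i\<in>{1..n}. a i + b i)"
    have c: "a i \<le> c" "b i \<le> c" if "i \<in> {1..n}" for i
      using member_le_sum[OF that, of "\<lambda>i. a i + b i"] by (simp_all add: c_def)
    have "fst (part t) \<in> {t. keys t \<subseteq> {1..n} \<and> (\<forall>i. lookup t i \<le> c)}" if t: "t \<in> EI - EJ" for t
    proof (intro CollectI conjI allI)
      show keys: "keys (fst (part t)) \<subseteq> {1..n}" using keys_vec by (simp add: part_def)
      fix i
      note ivt = iv[OF t] G[OF iv[OF t, THEN conjunct1]]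
      show "lookup (fst (part t)) i \<le> c"
      proof (cases "i \<in> {1..n}")
        case False
        with keys have "lookup (fst (part t)) i = 0" by (auto simp: in_keys_iff)
        then show ?thesis by simp
      next
        case True
        have "lookup t i \<le> c" if "i \<notin> snd (iv t)"
        proof (cases "i \<in> {1..m}")
          case im: True
          then have "lookup t i < b i" using t unfolding exponents_iff by blast
          then show ?thesis using c(2)[OF True] by linarith
        next
          case False
          with True have "i \<in> P" by auto
          moreover have "i \<notin> supp t" using ivt that by blast
          ultimately have "lookup t i < a i" by (simp add: supp_def)
          then show ?thesis using c(1)[OF True] by linarith
        qed
        then show ?thesis using c(1)[OF True] by (simp add: apex[OF t])
      qed
    qed
    moreover have "snd (part t) \<in> Pow P" if t: "t \<in> EI - EJ" for t
      using iv[OF t] G[of "iv t" t] by (auto simp: part_def)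
    ultimately have "part ` (EI - EJ) \<subseteq> {t. keys t \<subseteq> {1..n} \<and> (\<forall>i. lookup t i \<le> c)} \<times> Pow P"
      unfolding image_subset_iff mem_Times_iff by blast
    then show "finite (part ` (EI - EJ))"
      by (rule finite_subset) (intro finite_cartesian_product finite_bounded_exponents, simp)
  qed
qed

lemma stanley_decomposition_exists:
  obtains D where "is_stanley_decomposition n M (quot_grading n I J) D"
    "(n - m + 1) div 2 \<le> decomposition_sdepth D"
proof -
  obtain part where part:
    "\<And>t. t \<in> EI - EJ \<Longrightarrow> t \<in> cone (fst (part t)) (snd (part t))"
    "\<And>t s. t \<in> EI - EJ \<Longrightarrow> s \<in> cone (fst (part t)) (snd (part t)) \<Longrightarrow> s \<in> EI - EJ \<and> part s = part t"
    "\<And>t. t \<in> EI - EJ \<Longrightarrow> snd (part t) \<subseteq> {1..n} \<and> n - m \<le> 2 * card (snd (part t))"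
    "finite (part ` (EI - EJ))"
    by (rule cone_partition_exists) blast
  obtain L where L: "set L = part ` (EI - EJ)" "distinct L"
    using finite_distinct_list[OF part(4)] by blast
  let ?D = "map (\<lambda>(t, Z). (coset (monomial t (1 :: 'k)), Z)) L"
  have "is_stanley_decomposition n M (quot_grading n I J) ?D"
  proof (rule stanley_decomposition_of_cones)
    fix u Z assume "(u, Z) \<in> set L"
    then obtain t where t: "t \<in> EI - EJ" "part t = (u, Z)" using L(1) by auto
    have "s \<in> EI - EJ" if "s \<in> cone u Z" for s
      using part(2)[OF t(1), of s] t(2) that by simp
    moreover have "Z \<subseteq> {1..n}" using part(3)[OF t(1)] t(2) by simp
    ultimately show "Z \<subseteq> {1..n} \<and> cone u Z \<subseteq> EI - EJ" by blast
  next
    fix t assume t: "t \<in> EI - EJ"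
    then have "part t \<in> set L" using L(1) by blast
    then obtain i where i: "i < length L" "L ! i = part t" by (auto simp: in_set_conv_nth)
    show "\<exists>!i. i < length L \<and> t \<in> cone (fst (L ! i)) (snd (L ! i))"
    proof (rule ex1I[of _ i])
      show "i < length L \<and> t \<in> cone (fst (L ! i)) (snd (L ! i))" using i part(1)[OF t] by simp
      fix j assume j: "j < length L \<and> t \<in> cone (fst (L ! j)) (snd (L ! j))"
      then obtain s where s: "s \<in> EI - EJ" "L ! j = part s" using L(1) nth_mem[of j L] by auto
      then have "L ! j = L ! i" using part(2)[OF s(1), of t] j i by simp
      with nth_eq_iff_index_eq[OF L(2)] i(1) j show "j = i" by blast
    qed
  qed
  moreover have "(n - m + 1) div 2 \<le> decomposition_sdepth ?D"
  proof (cases "L = []")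
    case True
    then have "EI - EJ = {}" using L(1) by simp
    then have "P = {}" using var_w_exponent by blast
    then show ?thesis by simp
  next
    case False
    have "(n - m + 1) div 2 \<le> card Z" if uZ: "(u, Z) \<in> set L" for u Z
    proof -
      obtain t where t: "t \<in> EI - EJ" "part t = (u, Z)" using L(1) uZ by auto
      then have "n - m \<le> 2 * card Z" using part(3)[OF t(1)] by simp
      then show ?thesis by linarith
    qed
    with False show ?thesis by (auto simp: decomposition_sdepth_def)
  qed
  ultimately show ?thesis using that by blast
qed

lemma sdepth_eq: "sdepth n M (quot_grading n I J) = (n - m + 1) div 2"
  unfolding sdepth_def
proof (rule Max_eqI)
  let ?S = "{decomposition_sdepth D | D. is_stanley_decomposition n M (quot_grading n I J) D}"
  have "?S \<subseteq> {..(n - m + 1) div 2}" using decomposition_sdepth_le by auto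
  then show "finite ?S" by (rule finite_subset) simp
  show "y \<le> (n - m + 1) div 2" if "y \<in> ?S" for y using that decomposition_sdepth_le by auto
  obtain D where D: "is_stanley_decomposition n M (quot_grading n I J) D"
    "(n - m + 1) div 2 \<le> decomposition_sdepth D"
    by (rule stanley_decomposition_exists) blast
  then have "(n - m + 1) div 2 = decomposition_sdepth D"
    using decomposition_sdepth_le[OF D(1)] by linarith
  with D(1) show "(n - m + 1) div 2 \<in> ?S" by blast
qed

text \<open>For \<open>m < n\<close> the Stanley depth is at least \<open>1\<close> and \<open>x\<^sub>n\<close> is regular on \<open>S/J\<close>. For \<open>m = n\<close> and \<open>I \<noteq> J\<close> the
monomial with exponents \<open>b\<^sub>i - 1\<close> spans the socle of \<open>S/J\<close> and lies in \<open>I\<close>.\<close>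

lemma depth_le_sdepth: "depth n M \<le> enat (sdepth n M (quot_grading n I J))"
proof (cases "m = n")
  case False
  then have n: "n \<in> P" using m_le_n by auto
  define u where "u = monomial n (a n)"
  have "u \<in> EI" using n by (auto simp: u_def pure_power_exponents_def intro!: bexI[of _ n])
  moreover have "t \<in> EJ" if "t + u \<in> EJ" for t
    using that n by (auto simp: u_def pure_power_exponents_def keys_add_nat lookup_add lookup_single when_def)
  ultimately have "depth n M \<le> 1"
    using w_notin_EI w_keys var_w_in_EI by (intro depth_le_1_if_socle) auto
  also have "1 \<le> enat (sdepth n M (quot_grading n I J))"
    using n by (simp add: sdepth_eq one_enat_def)
  finally show ?thesis .
next
  case mn: True
  have "depth n M = 0"
  proof (cases "\<forall>i\<in>{1..n}. a i = b i")
    case True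
    then have "EI = EJ" using mn by (auto simp: pure_power_exponents_def)
    then show ?thesis by (rule depth_eq_0_if_trivial)
  next
    case False
    then obtain i where i: "i \<in> {1..n}" "a i \<noteq> b i" by blast
    define v where "v = vec n (\<lambda>i. b i - 1)"
    have b: "1 \<le> b i \<and> a i \<le> b i" if "i \<in> {1..n}" for i
      using a_pos[of i] a_le_b[of i] that mn by auto
    have "a i < b i" using i b[OF i(1)] by simp
    then have "a i \<le> lookup v i" using i(1) by (simp add: v_def lookup_vec)
    moreover have keys: "keys v \<subseteq> {1..n}" unfolding v_def by (rule keys_vec)
    ultimately have "v \<in> EI" using i(1) by (auto simp: pure_power_exponents_def)
    moreover have "lookup v j < b j" if "j \<in> {1..n}" for j
      using b[OF that] that by (simp add: v_def lookup_vec)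
    then have "v \<notin> EJ" using mn by (force simp: pure_power_exponents_def)
    moreover have "monomial j 1 + v \<in> EJ" if j: "j \<in> {1..n}" for j
    proof -
      have "keys (monomial j 1 + v) \<subseteq> {1..n}" using j keys by (simp add: keys_add_nat)
      moreover have "b j \<le> lookup (monomial j 1 + v) j" using j by (simp add: lookup_add v_def lookup_vec)
      ultimately show ?thesis using j mn unfolding pure_power_exponents_def by blast
    qed
    ultimately show ?thesis by (rule depth_eq_0_if_socle)
  qed
  then show ?thesis by simp
qed

end

theorem theorem1p5:
  fixes n m :: nat and a b :: "nat \<Rightarrow> nat" and I J :: "'k::field mpoly set"
  assumes "m \<le> n"
    and "\<forall>i\<in>{1..n}. 1 \<le> a i"
    and "\<forall>i\<in>{1..m}. a i \<le> b i"
    and "I = Idl\<^bsub>poly_ring n\<^esub> {var i ^ a i | i. i \<in> {1..n}}"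
    and "J = Idl\<^bsub>poly_ring n\<^esub> {var i ^ b i | i. i \<in> {1..m}}"
  shows "int (sdepth n (quot_module (poly_ring n) I J) (quot_grading n I J))
           = int n - int m - \<lfloor>(real n - real m) / 2\<rfloor>
       \<and> enat (sdepth n (quot_module (poly_ring n) I J) (quot_grading n I J))
           \<ge> depth n (quot_module (poly_ring n) I J)"
proof -
  interpret pure_power_quotient n m a b I J
  proof
    show "I = monomial_space (pure_power_exponents n {1..n} a)"
      using assms(4) genideal_pure_powers[of "{1..n}" n a, where 'k = 'k] by simp
    show "J = monomial_space (pure_power_exponents n {1..m} b)"
      using assms(1,5) genideal_pure_powers[of "{1..m}" n b, where 'k = 'k] by simp
  qed (use assms(1-3) in auto)
  have "\<lfloor>(real n - real m) / 2\<rfloor> = int ((n - m) div 2)"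
    using floor_divide_of_nat_eq[of "n - m" 2, where 'a = real] assms(1) by (simp add: of_nat_diff)
  moreover have "int ((n - m + 1) div 2) = int (n - m) - int ((n - m) div 2)"
    by linarith
  ultimately have "int (sdepth n M (quot_grading n I J)) = int n - int m - \<lfloor>(real n - real m) / 2\<rfloor>"
    using assms(1) by (simp add: sdepth_eq of_nat_diff)
  with depth_le_sdepth show ?thesis by blast
qed

end
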